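(* Consider the Gaussian sequence experiment with information level $n$, $Y_j=\kappa_j\theta_j+n^{-1/2}\varepsilon_j$, $j\ge 1$, where the $\varepsilon_j\sim N(0,\sigma^2)$ and the $\theta_j\sim N(0,\tau_j^2)$ are all mutually independent, $\kappa_j>0$, $\tau_j>0$, $\sigma>0$. Let $a_j=\kappa_j^2\tau_j^2/\sigma^2$. Suppose that $-\log a_j\sim c\,j^\beta$ as $j\to\infty$, where $c>0$ and $\beta>0$. Then, as $n\to\infty$, \[ 2I(\theta;Y)\sim\frac{\beta}{\beta+1}\,c^{-1/\beta}(\log n)^{1+1/\beta}, \] and consequently \[ d_{\rm eff}(n)\sim\frac{\beta}{\beta+1}\,c^{-1/\beta}(\log n)^{1/\beta}. \]
   Context: $\theta=(\theta_j)_{j\ge1}$, $Y=(Y_j)_{j\ge1}$. $I(U;V)=\mathrm{KL}(P_{U,V}\,\|\,P_U\otimes P_V)$ denotes mutual information (natural logarithm), here under the joint prior–sampling law of $(\theta,Y)$ at information level $n$. The sequences $\kappa_j,\tau_j$ and $\sigma$ do not depend on $n$. Whenever $\sum_j a_j<\infty$ one has $2I(\theta;Y)=\sum_{j\ge1}\log(1+na_j)$. The Bayesian effective dimension is $d_{\rm eff}(n)=2I(\theta;Y)/\log n$ for $n\ge3$. The hypothesis on $(a_j)$ may be imposed on any enumeration of the coordinates; monotonicity of $(a_j)$ is not required. The notation $f\sim g$ means $f/g\to1$. *)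

theory Defs
  imports "HOL-Probability.Probability"
begin

text \<open>
  Sequences \<open>(x\<^sub>j)\<close> with \<open>j \<ge> 1\<close> are points of the countable product of real lines over the
  index set \<open>{1..}\<close>; the coordinate \<open>j = 0\<close> of the functions below is never used.
\<close>

abbreviation seq_space :: "(nat \<Rightarrow> real) measure" where
  "seq_space \<equiv> \<Pi>\<^sub>M j\<in>{1..}. (borel :: real measure)"

definition random_seq :: "(nat \<Rightarrow> 'a \<Rightarrow> real) \<Rightarrow> 'a \<Rightarrow> nat \<Rightarrow> real" where
  "random_seq X \<omega> = (\<lambda>j\<in>{1..}. X j \<omega>)"

definition observation ::
  "(nat \<Rightarrow> real) \<Rightarrow> (nat \<Rightarrow> 'a \<Rightarrow> real) \<Rightarrow> (nat \<Rightarrow> 'a \<Rightarrow> real) \<Rightarrow> real \<Rightarrow> nat \<Rightarrow> 'a \<Rightarrow> real" where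
  "observation \<kappa> \<theta> \<epsilon> n j \<omega> = \<kappa> j * \<theta> j \<omega> + n powr (-1/2) * \<epsilon> j \<omega>"

text \<open>
  In \<open>normal_density \<mu> s\<close> the parameter \<open>s\<close> is the standard deviation. The disjoint sum
  \<open>{1..} <+> {1..}\<close> indexes the combined family of all \<open>\<theta>\<^sub>j\<close> and all \<open>\<epsilon>\<^sub>j\<close>, so that independence
  is joint over both sequences.
\<close>

locale gaussian_sequence_experiment = prob_space M
  for M :: "'a measure" +
  fixes \<theta> \<epsilon> :: "nat \<Rightarrow> 'a \<Rightarrow> real"
    and \<kappa> \<tau> :: "nat \<Rightarrow> real"
    and \<sigma> :: real
  assumes \<kappa>_pos: "\<And>j. j \<ge> 1 \<Longrightarrow> \<kappa> j > 0"
    and \<tau>_pos: "\<And>j. j \<ge> 1 \<Longrightarrow> \<tau> j > 0"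
    and \<sigma>_pos: "\<sigma> > 0"
    and \<theta>_normal: "\<And>j. j \<ge> 1 \<Longrightarrow> distributed M lborel (\<theta> j) (normal_density 0 (\<tau> j))"
    and \<epsilon>_normal: "\<And>j. j \<ge> 1 \<Longrightarrow> distributed M lborel (\<epsilon> j) (normal_density 0 \<sigma>)"
    and indep: "indep_vars (\<lambda>_. borel) (case_sum \<theta> \<epsilon>) ({1..} <+> {1..})"

text \<open>
  The mutual information \<open>I(\<theta>; Y)\<close> at level \<open>n\<close>, in nats. The library's \<open>mutual_information\<close> is
  real-valued: it takes the value \<open>0\<close> when the joint law is not absolutely continuous with respect
  to the product of the marginals, or when the log-density is not integrable. Hence a positive
  value is always a genuine, finite Kullback--Leibler divergence.
\<close>

definition mutual_info ::
  "'a measure \<Rightarrow> (nat \<Rightarrow> 'a \<Rightarrow> real) \<Rightarrow> (nat \<Rightarrow> 'a \<Rightarrow> real) \<Rightarrow> (nat \<Rightarrow> real) \<Rightarrow> real \<Rightarrow> real" where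
  "mutual_info M \<theta> \<epsilon> \<kappa> n =
     prob_space.mutual_information M (exp 1) seq_space seq_space
       (random_seq \<theta>) (random_seq (observation \<kappa> \<theta> \<epsilon> n))"

definition effective_dim ::
  "'a measure \<Rightarrow> (nat \<Rightarrow> 'a \<Rightarrow> real) \<Rightarrow> (nat \<Rightarrow> 'a \<Rightarrow> real) \<Rightarrow> (nat \<Rightarrow> real) \<Rightarrow> real \<Rightarrow> real" where
  "effective_dim M \<theta> \<epsilon> \<kappa> n = 2 * mutual_info M \<theta> \<epsilon> \<kappa> n / ln n"

end

theory Submission
  imports Defs "HOL-Real_Asymp.Real_Asymp"
begin

text \<open>
  Write \<open>a\<^sub>j = e\<^bsup>-q\<^sub>j\<^esup>\<close> with \<open>q\<^sub>j \<sim> c j\<^sup>\<beta>\<close>. In each coordinate the joint law of \<open>(\<theta>\<^sub>j, Y\<^sub>j)\<close> has an explicit density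
  with respect to the product of its marginals, whose logarithm has mean \<open>ln (1 + n a\<^sub>j) / 2\<close> and is
  of size \<open>n a\<^sub>j + sqrt (n a\<^sub>j)\<close> in \<open>L\<^sup>1\<close> under both laws. As \<open>sqrt a\<^sub>j\<close> is summable, the infinite product
  of these densities converges in \<open>L\<^sup>1\<close> to the density of the joint law of the two sequences, so
  \<open>2 I(\<theta>; Y)\<close> is the series of the \<open>ln (1 + n a\<^sub>j)\<close>. With \<open>T = ln n\<close> its terms are
  \<open>ln (1 + e\<^bsup>T - q\<^sub>j\<^esup>)\<close>, and rescaling \<open>j\<close> by \<open>T\<^bsup>1/\<beta>\<^esup>\<close> turns the series, divided by
  \<open>T\<^bsup>1 + 1/\<beta>\<^esup>\<close>, into an integral that converges by domination to the integral of the positive part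
  of \<open>1 - c x\<^sup>\<beta>\<close>.
\<close>

section \<open>Densities of infinite product measures\<close>

text \<open>Almost sure convergence of the product of the coordinate densities could lose mass in
  the limit, which would then fail to be the density of the joint law; convergence in L^1 excludes
  this. Each log-density fluctuates on the scale sqrt (n a_j), so first absolute moments call for
  summability of sqrt a_j, which the stretched exponential decay of a_j grants. Exhibiting the
  density also matters because the divergence in the definition is real-valued with default values:
  only a density with integrable logarithm shows that the computed number is the true information.
  In the exponent 1 + 1/\<beta>, the summand 1 is the size T of a typical term and 1/\<beta> counts
  the coordinates with a_j > 1/n, of order T^(1/\<beta>). The constant is the area X - X / (\<beta>
  + 1) under 1 - c x^\<beta> up to its zero X = c^(-1/\<beta>).\<close>

lemma AE_summable_if_summable_integral:
  fixes f :: "nat \<Rightarrow> 'a \<Rightarrow> real"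
  assumes f: "\<And>k. integrable M (f k)"
    and sum: "summable (\<lambda>k. \<integral>x. \<bar>f k x\<bar> \<partial>M)"
  shows "AE x in M. summable (\<lambda>k. \<bar>f k x\<bar>)"
proof -
  have [measurable]: "f k \<in> borel_measurable M" for k
    using f by auto
  have "(\<integral>\<^sup>+x. (\<Sum>k. ennreal \<bar>f k x\<bar>) \<partial>M) = (\<Sum>k. \<integral>\<^sup>+x. ennreal \<bar>f k x\<bar> \<partial>M)"
    by (rule nn_integral_suminf) measurable
  also have "\<dots> = (\<Sum>k. ennreal (\<integral>x. \<bar>f k x\<bar> \<partial>M))"
    using f by (intro suminf_cong nn_integral_eq_integral) auto
  also have "\<dots> \<noteq> \<infinity>"
    using sum by (subst suminf_ennreal2) auto
  finally have "AE x in M. (\<Sum>k. ennreal \<bar>f k x\<bar>) \<noteq> \<infinity>"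
    by (intro nn_integral_PInf_AE) auto
  then show ?thesis
    by eventually_elim (auto intro!: summable_suminf_not_top)
qed

text \<open>The tangent bound 1 + t \<le> e^t gives both cases: at t = -x, multiplied by e^x, for x
  \<ge> 0, and at t = x otherwise.\<close>

lemma abs_exp_minus_one_le: "\<bar>exp x - 1\<bar> \<le> \<bar>x\<bar> * (1 + exp x)" for x :: real
proof (cases "x \<ge> 0")
  case True
  have "1 - x \<le> exp (- x)"
    using exp_ge_add_one_self[of "- x"] by simp
  then have "(1 - x) * exp x \<le> exp (- x) * exp x"
    by (intro mult_right_mono) auto
  then show ?thesis
    using True by (simp add: algebra_simps flip: exp_add)
next
  case False
  have "1 + x \<le> exp x"
    by (rule exp_ge_add_one_self)
  moreover have "0 \<le> - x * exp x"
    using False by (intro mult_nonneg_nonneg) auto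
  moreover have "\<bar>exp x - 1\<bar> = 1 - exp x" "\<bar>x\<bar> * (1 + exp x) = - x + - x * exp x"
    using False by (simp_all add: algebra_simps)
  ultimately show ?thesis
    by linarith
qed

text \<open>
  The partial products of the coordinate densities are Cauchy in \<open>L\<^sup>1\<close> because
  \<open>\<bar>e\<^sup>x - 1\<bar> \<le> \<bar>x\<bar> (1 + e\<^sup>x)\<close> bounds each increment by first absolute moments of the
  log-densities under both laws.
\<close>

lemma PiM_density_exp:
  fixes S :: "'i \<Rightarrow> 'b measure" and l :: "'i \<Rightarrow> 'b \<Rightarrow> real" and e :: "nat \<Rightarrow> 'i"
  assumes e: "bij_betw e UNIV I"
    and S: "\<And>i. i \<in> I \<Longrightarrow> prob_space (S i)"
    and R: "\<And>i. i \<in> I \<Longrightarrow> prob_space (density (S i) (\<lambda>x. ennreal (exp (l i x))))"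
    and int: "\<And>i. i \<in> I \<Longrightarrow> integrable (S i) (l i)"
    and int': "\<And>i. i \<in> I \<Longrightarrow> integrable (density (S i) (\<lambda>x. ennreal (exp (l i x)))) (l i)"
    and sum: "summable (\<lambda>k. \<integral>x. \<bar>l (e k) x\<bar> \<partial>S (e k))"
    and sum': "summable (\<lambda>k. \<integral>x. \<bar>l (e k) x\<bar> \<partial>density (S (e k)) (\<lambda>x. ennreal (exp (l (e k) x))))"
  shows "PiM I (\<lambda>i. density (S i) (\<lambda>x. ennreal (exp (l i x)))) =
    density (PiM I S) (\<lambda>\<omega>. ennreal (exp (\<Sum>k. l (e k) (\<omega> (e k)))))"
proof -
  define R where "R = (\<lambda>i. density (S i) (\<lambda>x. ennreal (exp (l i x))))"
  define Q where "Q = PiM I S"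
  have eI[simp]: "e k \<in> I" for k
    using e by (auto simp: bij_betw_def)
  have inj_e: "inj e"
    using e by (auto simp: bij_betw_def)
  have l_meas[measurable]: "l (e k) \<in> borel_measurable (S (e k))" for k
    using int by auto
  interpret Q: prob_space Q
    unfolding Q_def by (rule prob_space_PiM) (rule S)
  have coord[measurable]: "(\<lambda>\<omega>. \<omega> (e k)) \<in> measurable Q (S (e k))" for k
    unfolding Q_def by measurable
  have distr_coord: "distr Q (S (e k)) (\<lambda>\<omega>. \<omega> (e k)) = S (e k)" for k
    unfolding Q_def by (rule distr_PiM_component) (auto intro: S)
  have indep: "Q.indep_vars S (\<lambda>i \<omega>. \<omega> i) I"
  proof (subst Q.indep_vars_iff_distr_eq_PiM')
    show "I \<noteq> {}" using eI by blast
    show "Q.random_variable (S i) (\<lambda>\<omega>. \<omega> i)" if "i \<in> I" for i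
      using that by (auto simp: Q_def)
    have "distr Q (Pi\<^sub>M I S) (\<lambda>x. \<lambda>i\<in>I. x i) = distr Q Q (\<lambda>x. x)"
      by (rule distr_cong) (auto simp: Q_def space_PiM PiE_def extensional_restrict)
    also have "\<dots> = Q" by (rule distr_id)
    also have "\<dots> = (\<Pi>\<^sub>M i\<in>I. distr Q (S i) (\<lambda>x. x i))"
      unfolding Q_def by (intro PiM_cong refl distr_PiM_component[symmetric]) (auto intro: S)
    finally show "distr Q (Pi\<^sub>M I S) (\<lambda>x. \<lambda>i\<in>I. x i) = (\<Pi>\<^sub>M i\<in>I. distr Q (S i) (\<lambda>x. x i))" .
  qed
  have int_exp_eq: "(\<integral>\<^sup>+x. ennreal (exp (l (e k) x)) \<partial>S (e k)) = 1" for k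
  proof -
    interpret prob_space "density (S (e k)) (\<lambda>x. ennreal (exp (l (e k) x)))"
      by (rule R) simp
    show ?thesis
      using emeasure_space_1 by (simp add: emeasure_density cong: nn_integral_cong)
  qed
  \<comment> \<open>The independent family is indexed by \<open>I\<close> while the factors are
    numbered by \<open>k\<close>; \<open>inv e\<close> carries the numbering back to
    \<open>I\<close>.\<close>
  have prod_integral: "(\<integral>\<^sup>+\<omega>. (\<Prod>k<N. g k (\<omega> (e k))) \<partial>Q) = (\<Prod>k<N. \<integral>\<^sup>+x. g k x \<partial>S (e k))"
    if g[measurable]: "\<And>k. g k \<in> borel_measurable (S (e k))" for g :: "nat \<Rightarrow> 'b \<Rightarrow> ennreal" and N
  proof -
    have inv_e: "inv e (e k) = k" for k
      using inj_e by (rule inv_f_f)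
    have reindex: "(\<Prod>i\<in>e ` {..<N}. F i) = (\<Prod>k<N. F (e k))" for F :: "'i \<Rightarrow> ennreal"
      using prod.reindex[OF inj_on_subset[OF inj_e subset_UNIV]] by simp
    have *: "Q.indep_vars (\<lambda>k. borel) (\<lambda>i \<omega>. g (inv e i) (\<omega> i)) (e ` {..<N})"
    proof (rule Q.indep_vars_compose2[where M' = S and Y = "\<lambda>i. g (inv e i)"])
      show "Q.indep_vars S (\<lambda>i \<omega>. \<omega> i) (e ` {..<N})"
        using indep by (rule Q.indep_vars_subset) auto
      show "g (inv e i) \<in> measurable (S i) borel" if "i \<in> e ` {..<N}" for i
      proof -
        obtain k where "i = e k" using \<open>i \<in> e ` {..<N}\<close> by blast
        then show ?thesis using g[of k] inv_e by simp
      qed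
    qed
    have "(\<integral>\<^sup>+\<omega>. (\<Prod>k<N. g k (\<omega> (e k))) \<partial>Q) = (\<integral>\<^sup>+\<omega>. (\<Prod>i\<in>e ` {..<N}. g (inv e i) (\<omega> i)) \<partial>Q)"
      by (simp only: reindex inv_e)
    also have "\<dots> = (\<Prod>i\<in>e ` {..<N}. \<integral>\<^sup>+\<omega>. g (inv e i) (\<omega> i) \<partial>Q)"
      by (rule Q.indep_vars_nn_integral) (auto intro: *)
    also have "\<dots> = (\<Prod>k<N. \<integral>\<^sup>+\<omega>. g k (\<omega> (e k)) \<partial>Q)"
      by (simp only: reindex inv_e)
    also have "\<dots> = (\<Prod>k<N. \<integral>\<^sup>+x. g k x \<partial>distr Q (S (e k)) (\<lambda>\<omega>. \<omega> (e k)))"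
      by (simp add: nn_integral_distr[OF coord])
    finally show ?thesis by (simp add: distr_coord)
  qed
  have Q_coord: "integrable Q (\<lambda>\<omega>. l (e k) (\<omega> (e k)))"
      "(\<integral>\<omega>. \<bar>l (e k) (\<omega> (e k))\<bar> \<partial>Q) = (\<integral>x. \<bar>l (e k) x\<bar> \<partial>S (e k))" for k
  proof -
    have "integrable (distr Q (S (e k)) (\<lambda>\<omega>. \<omega> (e k))) (l (e k))"
      by (simp add: distr_coord int)
    then show "integrable Q (\<lambda>\<omega>. l (e k) (\<omega> (e k)))"
      by (subst (asm) integrable_distr_eq) auto
    have "(\<integral>\<omega>. \<bar>l (e k) (\<omega> (e k))\<bar> \<partial>Q) = (\<integral>x. \<bar>l (e k) x\<bar> \<partial>distr Q (S (e k)) (\<lambda>\<omega>. \<omega> (e k)))"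
      by (subst integral_distr) auto
    then show "(\<integral>\<omega>. \<bar>l (e k) (\<omega> (e k))\<bar> \<partial>Q) = (\<integral>x. \<bar>l (e k) x\<bar> \<partial>S (e k))"
      by (simp add: distr_coord)
  qed
  have AE_l: "AE \<omega> in Q. summable (\<lambda>k. \<bar>l (e k) (\<omega> (e k))\<bar>)"
    using sum by (intro AE_summable_if_summable_integral) (simp_all add: Q_coord)
  define f where "f = (\<lambda>N \<omega>. \<Prod>k<N. exp (l (e k) (\<omega> (e k))))"
  have f_meas[measurable]: "f N \<in> borel_measurable Q" for N
    unfolding f_def by measurable
  have f_pos: "f N \<omega> \<ge> 0" for N \<omega>
    by (auto simp: f_def intro!: prod_nonneg)
  have f_int_eq: "(\<integral>\<^sup>+\<omega>. ennreal (f N \<omega>) \<partial>Q) = 1" for N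
    using prod_integral[of "\<lambda>k x. ennreal (exp (l (e k) x))" N]
    by (simp add: f_def prod_ennreal int_exp_eq)
  have f_int: "integrable Q (f N)" for N
    using f_int_eq[of N] f_pos by (intro integrableI_nonneg) auto
  have f_lim: "AE \<omega> in Q. (\<lambda>N. f N \<omega>) \<longlonglongrightarrow> exp (\<Sum>k. l (e k) (\<omega> (e k)))"
    using AE_l
  proof eventually_elim
    case (elim \<omega>)
    then have "(\<lambda>N. \<Sum>k<N. l (e k) (\<omega> (e k))) \<longlonglongrightarrow> (\<Sum>k. l (e k) (\<omega> (e k)))"
      by (rule summable_LIMSEQ[OF summable_rabs_cancel])
    then show ?case
      unfolding f_def exp_sum[symmetric, OF finite_lessThan] by (rule tendsto_exp)
  qed
  \<comment> \<open>The increment equals \<open>f N\<close> times a function of the fresh coordinate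
    \<open>e N\<close> alone, so its absolute integral factorises.\<close>
  define d where "d = (\<lambda>N \<omega>. f (Suc N) \<omega> - f N \<omega>)"
  have d_int: "integrable Q (d N)" for N
    unfolding d_def using f_int by auto
  have d_bound: "(\<integral>\<omega>. \<bar>d N \<omega>\<bar> \<partial>Q) \<le> (\<integral>x. \<bar>l (e N) x\<bar> \<partial>S (e N)) + (\<integral>x. \<bar>l (e N) x\<bar> \<partial>R (e N))" for N
  proof -
    \<comment> \<open>For k > N this would put \<open>l (e N)\<close> on the space
      \<open>S (e k)\<close>, where its measurability is unknown; hence the padding by the constant
      1 beyond N in the product below.\<close>
    let ?g = "\<lambda>k x. if k < N then ennreal (exp (l (e k) x)) else ennreal \<bar>exp (l (e N) x) - 1\<bar>"
    have g_meas: "?g k \<in> borel_measurable (S (e k))" if "k \<le> N" for k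
      using that by (cases "k = N") auto
    have "ennreal (\<integral>\<omega>. \<bar>d N \<omega>\<bar> \<partial>Q) = (\<integral>\<^sup>+\<omega>. ennreal \<bar>d N \<omega>\<bar> \<partial>Q)"
      using d_int by (intro nn_integral_eq_integral[symmetric]) auto
    also have "\<dots> = (\<integral>\<^sup>+\<omega>. (\<Prod>k<Suc N. (if k \<le> N then ?g k else (\<lambda>_. 1)) (\<omega> (e k))) \<partial>Q)"
    proof (rule nn_integral_cong)
      fix \<omega>
      have "d N \<omega> = f N \<omega> * (exp (l (e N) (\<omega> (e N))) - 1)"
        by (simp add: d_def f_def algebra_simps)
      then have "ennreal \<bar>d N \<omega>\<bar> = ennreal (f N \<omega>) * ennreal \<bar>exp (l (e N) (\<omega> (e N))) - 1\<bar>"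
        using f_pos by (simp add: abs_mult ennreal_mult)
      also have "ennreal (f N \<omega>) = (\<Prod>k<N. ennreal (exp (l (e k) (\<omega> (e k)))))"
        by (simp add: f_def prod_ennreal)
      finally show "ennreal \<bar>d N \<omega>\<bar> = (\<Prod>k<Suc N. (if k \<le> N then ?g k else (\<lambda>_. 1)) (\<omega> (e k)))"
        by simp
    qed
    also have "\<dots> = (\<Prod>k<Suc N. \<integral>\<^sup>+x. (if k \<le> N then ?g k else (\<lambda>_. 1)) x \<partial>S (e k))"
      using g_meas by (intro prod_integral) (auto split: if_split)
    also have "\<dots> = (\<integral>\<^sup>+x. ennreal \<bar>exp (l (e N) x) - 1\<bar> \<partial>S (e N))"
      by (simp add: int_exp_eq)
    also have "\<dots> \<le> (\<integral>\<^sup>+x. ennreal \<bar>l (e N) x\<bar> + ennreal (exp (l (e N) x)) * ennreal \<bar>l (e N) x\<bar> \<partial>S (e N))"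
    proof (rule nn_integral_mono)
      fix x
      have "ennreal \<bar>exp (l (e N) x) - 1\<bar> \<le> ennreal (\<bar>l (e N) x\<bar> * (1 + exp (l (e N) x)))"
        by (intro ennreal_leI abs_exp_minus_one_le)
      also have "\<dots> = ennreal \<bar>l (e N) x\<bar> + ennreal (exp (l (e N) x)) * ennreal \<bar>l (e N) x\<bar>"
        by (simp add: algebra_simps flip: ennreal_mult ennreal_plus)
      finally show "ennreal \<bar>exp (l (e N) x) - 1\<bar> \<le> \<dots>" .
    qed
    also have "\<dots> = (\<integral>\<^sup>+x. ennreal \<bar>l (e N) x\<bar> \<partial>S (e N)) + (\<integral>\<^sup>+x. ennreal \<bar>l (e N) x\<bar> \<partial>R (e N))"
      unfolding R_def by (subst nn_integral_add) (auto simp: nn_integral_density)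
    also have "\<dots> = ennreal (\<integral>x. \<bar>l (e N) x\<bar> \<partial>S (e N)) + ennreal (\<integral>x. \<bar>l (e N) x\<bar> \<partial>R (e N))"
      using int int' by (intro arg_cong2[where f="(+)"] nn_integral_eq_integral) (auto simp: R_def)
    finally show ?thesis
      by (simp add: integral_nonneg_AE flip: ennreal_plus)
  qed
  have d_sum: "summable (\<lambda>N. \<integral>\<omega>. \<bar>d N \<omega>\<bar> \<partial>Q)"
  proof (rule summable_comparison_test')
    show "summable (\<lambda>N. (\<integral>x. \<bar>l (e N) x\<bar> \<partial>S (e N)) + (\<integral>x. \<bar>l (e N) x\<bar> \<partial>R (e N)))"
      unfolding R_def using sum sum' by (rule summable_add)
    show "norm (\<integral>\<omega>. \<bar>d N \<omega>\<bar> \<partial>Q) \<le> (\<integral>x. \<bar>l (e N) x\<bar> \<partial>S (e N)) + (\<integral>x. \<bar>l (e N) x\<bar> \<partial>R (e N))" if "N \<ge> 0" for N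
      using d_bound[of N] by (simp add: abs_of_nonneg integral_nonneg_AE)
  qed
  note AE_d = AE_summable_if_summable_integral[OF d_int d_sum]
  define h where "h = (\<lambda>\<omega>. exp (\<Sum>k. l (e k) (\<omega> (e k))))"
  have h_meas[measurable]: "h \<in> borel_measurable Q"
    unfolding h_def by measurable
  have h_eq: "AE \<omega> in Q. h \<omega> = f m \<omega> + (\<Sum>N. d (N + m) \<omega>)" for m
    using f_lim
  proof eventually_elim
    case (elim \<omega>)
    then have "(\<lambda>N. f (N + m) \<omega>) \<longlonglongrightarrow> h \<omega>"
      unfolding h_def by (rule LIMSEQ_ignore_initial_segment)
    then have "(\<lambda>N. f (Suc N + m) \<omega> - f (N + m) \<omega>) sums (h \<omega> - f (0 + m) \<omega>)"
      by (rule telescope_sums)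
    then show ?case
      by (simp add: d_def sums_iff)
  qed
  \<comment> \<open>If the integrals over A are constant from m on, every later increment integrates
    to 0 over A; summability in L^1 permits integrating the telescoping series termwise, so
    \<open>h\<close> inherits the common value.\<close>
  have h_integral: "(\<integral>\<^sup>+\<omega>. ennreal (h \<omega>) * indicator A \<omega> \<partial>Q) = (\<integral>\<^sup>+\<omega>. ennreal (f m \<omega>) * indicator A \<omega> \<partial>Q)"
    if A[measurable]: "A \<in> sets Q"
      and stable: "\<And>N. N \<ge> m \<Longrightarrow> (\<integral>\<^sup>+\<omega>. ennreal (f N \<omega>) * indicator A \<omega> \<partial>Q) = (\<integral>\<^sup>+\<omega>. ennreal (f m \<omega>) * indicator A \<omega> \<partial>Q)"
    for A m
  proof -
    have fA: "integrable Q (\<lambda>\<omega>. f N \<omega> * indicator A \<omega>)" for N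
      using f_int by (intro integrable_real_mult_indicator) auto
    have fA': "(\<integral>\<^sup>+\<omega>. ennreal (f N \<omega>) * indicator A \<omega> \<partial>Q) = ennreal (\<integral>\<omega>. f N \<omega> * indicator A \<omega> \<partial>Q)" for N
      using fA f_pos by (subst nn_integral_eq_integral[symmetric])
        (auto intro!: nn_integral_cong simp: split: split_indicator)
    have stable': "(\<integral>\<omega>. f N \<omega> * indicator A \<omega> \<partial>Q) = (\<integral>\<omega>. f m \<omega> * indicator A \<omega> \<partial>Q)" if "N \<ge> m" for N
      using stable[OF that] f_pos unfolding fA' by (simp add: ennreal_inj integral_nonneg_AE)
    let ?u = "\<lambda>N \<omega>. d (N + m) \<omega> * indicator A \<omega>"
    have u_int: "integrable Q (?u N)" for N
      using d_int by (intro integrable_real_mult_indicator) auto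
    have u_sum: "summable (\<lambda>N. \<integral>\<omega>. norm (?u N \<omega>) \<partial>Q)"
    proof (rule summable_comparison_test')
      show "summable (\<lambda>N. \<integral>\<omega>. \<bar>d (N + m) \<omega>\<bar> \<partial>Q)"
        using d_sum by (rule summable_ignore_initial_segment)
      show "norm (\<integral>\<omega>. norm (?u N \<omega>) \<partial>Q) \<le> (\<integral>\<omega>. \<bar>d (N + m) \<omega>\<bar> \<partial>Q)" if "N \<ge> 0" for N
      proof -
        have "(\<integral>\<omega>. norm (?u N \<omega>) \<partial>Q) \<le> (\<integral>\<omega>. \<bar>d (N + m) \<omega>\<bar> \<partial>Q)"
          using u_int d_int by (intro integral_mono) (auto split: split_indicator)
        then show ?thesis by simp
      qed
    qed
    have u_AE: "AE \<omega> in Q. summable (\<lambda>N. norm (?u N \<omega>))"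
      using AE_summable_if_summable_integral[OF u_int] u_sum by simp
    have "(\<integral>\<omega>. (\<Sum>N. ?u N \<omega>) \<partial>Q) = (\<Sum>N. \<integral>\<omega>. ?u N \<omega> \<partial>Q)"
      by (rule integral_suminf[OF u_int u_AE u_sum])
    also have "\<dots> = 0"
    proof -
      have "(\<integral>\<omega>. ?u N \<omega> \<partial>Q) = 0" for N
        using stable'[of "Suc (N + m)"] stable'[of "N + m"] fA
        by (simp add: d_def left_diff_distrib)
      then show ?thesis by simp
    qed
    finally have u0: "(\<integral>\<omega>. (\<Sum>N. ?u N \<omega>) \<partial>Q) = 0" .
    have sum_u_int: "integrable Q (\<lambda>\<omega>. \<Sum>N. ?u N \<omega>)"
      by (rule integrable_suminf[OF u_int u_AE u_sum])
    have eq: "AE \<omega> in Q. h \<omega> * indicator A \<omega> = f m \<omega> * indicator A \<omega> + (\<Sum>N. ?u N \<omega>)"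
      using h_eq[of m] by eventually_elim (auto split: split_indicator)
    have h_int: "integrable Q (\<lambda>\<omega>. h \<omega> * indicator A \<omega>)"
      using Bochner_Integration.integrable_add[OF fA[of m] sum_u_int] eq
      by (subst integrable_cong_AE[OF _ _ eq]) auto
    have "(\<integral>\<^sup>+\<omega>. ennreal (h \<omega>) * indicator A \<omega> \<partial>Q) = (\<integral>\<^sup>+\<omega>. ennreal (h \<omega> * indicator A \<omega>) \<partial>Q)"
      by (intro nn_integral_cong) (auto split: split_indicator)
    also have "\<dots> = ennreal (\<integral>\<omega>. h \<omega> * indicator A \<omega> \<partial>Q)"
      using h_int by (intro nn_integral_eq_integral) (auto simp: h_def)
    also have "(\<integral>\<omega>. h \<omega> * indicator A \<omega> \<partial>Q) = (\<integral>\<omega>. f m \<omega> * indicator A \<omega> \<partial>Q) + 0"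
      using fA[of m] sum_u_int u0 by (subst integral_cong_AE[OF _ _ eq]) auto
    finally show ?thesis by (simp add: fA')
  qed
  \<comment> \<open>The infinite product is determined by its finite-dimensional cylinders.\<close>
  have "PiM I R = density Q (\<lambda>\<omega>. ennreal (h \<omega>))"
  proof (rule measure_eqI_PiM_infinite[OF refl])
    show sets_eq: "sets (density Q (\<lambda>\<omega>. ennreal (h \<omega>))) = sets (Pi\<^sub>M I R)"
      by (auto simp: Q_def R_def intro!: sets_PiM_cong)
    have "prob_space (PiM I R)"
      by (rule prob_space_PiM) (simp add: R R_def)
    then show "finite_measure (PiM I R)"
      by (rule prob_space.finite_measure)
    fix J F assume J: "finite J" "J \<subseteq> I" and F: "\<And>j. j \<in> J \<Longrightarrow> F j \<in> sets (R j)"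
    let ?A = "prod_emb I R J (Pi\<^sub>E J F)"
    have A_eq: "?A = {\<omega> \<in> space Q. \<forall>j\<in>J. \<omega> j \<in> F j}"
      using J by (auto simp: prod_emb_def Q_def space_PiM R_def PiE_def Pi_iff)
    have A: "?A \<in> sets Q"
      using sets_eq J F by (simp add: sets_PiM_I)
    \<comment> \<open>Beyond such an m no factor of \<open>f N\<close> touches the coordinates in J,
      so each further factor integrates to 1 and the integral over the cylinder is stable.\<close>
    have "finite (e -` J)"
      using J inj_e by (intro finite_vimageI) auto
    then obtain m where m: "e -` J \<subseteq> {..<m}"
      using finite_nat_iff_bounded by auto
    have step: "(\<integral>\<^sup>+\<omega>. ennreal (f N \<omega>) * indicator ?A \<omega> \<partial>Q) = (\<Prod>j\<in>J. emeasure (R j) (F j))" if "N \<ge> m" for N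
    proof -
      \<comment> \<open>Coordinates outside J carry the whole space, so each contributes the total
        mass 1 of \<open>R (e k)\<close>.\<close>
      let ?G = "\<lambda>k. if e k \<in> J then F (e k) else space (S (e k))"
      have G[measurable]: "?G k \<in> sets (S (e k))" for k
        using F[of "e k"] by (auto simp: R_def)
      have "(\<integral>\<^sup>+\<omega>. ennreal (f N \<omega>) * indicator ?A \<omega> \<partial>Q) =
        (\<integral>\<^sup>+\<omega>. (\<Prod>k<N. ennreal (exp (l (e k) (\<omega> (e k)))) * indicator (?G k) (\<omega> (e k))) \<partial>Q)"
      proof (rule nn_integral_cong)
        fix \<omega> assume \<omega>: "\<omega> \<in> space Q"
        have "indicator ?A \<omega> = (\<Prod>k<N. indicator (?G k) (\<omega> (e k)) :: ennreal)"
        proof (cases "\<omega> \<in> ?A")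
          case True
          moreover have "\<omega> (e k) \<in> space (S (e k))" for k
            using measurable_space[OF coord \<omega>] .
          ultimately show ?thesis
            by (auto simp: A_eq intro!: prod.neutral[symmetric])
        next
          case False
          then obtain j where j: "j \<in> J" "\<omega> j \<notin> F j"
            using \<omega> by (auto simp: A_eq)
          then obtain k where k: "e k = j"
            using J e by (metis bij_betw_iff_bijections subsetD)
          then have "k < N"
            using m j that by auto
          then have "(\<Prod>k<N. indicator (?G k) (\<omega> (e k)) :: ennreal) = 0"
            using j k by (intro prod_zero) (auto intro!: bexI[of _ k])
          then show ?thesis using False by simp
        qed
        then show "ennreal (f N \<omega>) * indicator ?A \<omega> =
          (\<Prod>k<N. ennreal (exp (l (e k) (\<omega> (e k)))) * indicator (?G k) (\<omega> (e k)))"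
          by (simp add: f_def prod_ennreal prod.distrib)
      qed
      also have "\<dots> = (\<Prod>k<N. \<integral>\<^sup>+x. ennreal (exp (l (e k) x)) * indicator (?G k) x \<partial>S (e k))"
        by (intro prod_integral) measurable
      also have "\<dots> = (\<Prod>k<N. if e k \<in> J then emeasure (R (e k)) (F (e k)) else 1)"
      proof (intro prod.cong refl)
        fix k
        have "(\<integral>\<^sup>+x. ennreal (exp (l (e k) x)) * indicator (?G k) x \<partial>S (e k)) = emeasure (R (e k)) (?G k)"
          unfolding R_def by (subst emeasure_density) auto
        moreover have "emeasure (R (e k)) (space (S (e k))) = 1"
          using prob_space.emeasure_space_1[OF R[OF eI[of k]]] by (simp add: R_def)
        ultimately show "(\<integral>\<^sup>+x. ennreal (exp (l (e k) x)) * indicator (?G k) x \<partial>S (e k)) =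
            (if e k \<in> J then emeasure (R (e k)) (F (e k)) else 1)"
          by simp
      qed
      also have "\<dots> = (\<Prod>k\<in>e -` J. emeasure (R (e k)) (F (e k)))"
        using m that by (intro prod.mono_neutral_cong_right) auto
      also have "\<dots> = (\<Prod>j\<in>e ` (e -` J). emeasure (R j) (F j))"
        using prod.reindex[OF inj_on_subset[OF inj_e subset_UNIV], of "\<lambda>j. emeasure (R j) (F j)" "e -` J"] by simp
      also have "e ` (e -` J) = J"
        using J e by (auto simp: bij_betw_def)
      finally show ?thesis .
    qed
    have "emeasure (density Q (\<lambda>\<omega>. ennreal (h \<omega>))) ?A = (\<integral>\<^sup>+\<omega>. ennreal (h \<omega>) * indicator ?A \<omega> \<partial>Q)"
      using A by (subst emeasure_density) auto
    also have "\<dots> = (\<integral>\<^sup>+\<omega>. ennreal (f m \<omega>) * indicator ?A \<omega> \<partial>Q)"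
      using A step by (intro h_integral) auto
    also have "\<dots> = (\<Prod>j\<in>J. emeasure (R j) (F j))"
      by (rule step) simp
    also have "\<dots> = emeasure (PiM I R) ?A"
      using J F by (intro emeasure_PiM_emb[symmetric]) (auto simp: R R_def)
    finally show "emeasure (PiM I R) ?A = emeasure (density Q (\<lambda>\<omega>. ennreal (h \<omega>))) ?A" ..
  qed
  then show ?thesis by (simp add: R_def Q_def h_def)
qed

section \<open>The scalar Gaussian channel\<close>

text \<open>At z = (x, y) this is the log-likelihood ratio of N(\<kappa> x, \<rho>^2) against N(0,
  s^2), evaluated at y. It is the information density of the channel once s is the standard
  deviation of the output.\<close>

definition channel_log_density :: "real \<Rightarrow> real \<Rightarrow> real \<Rightarrow> real \<times> real \<Rightarrow> real" where
  "channel_log_density \<kappa> \<rho> s z =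
     ln (s / \<rho>) - (snd z - \<kappa> * fst z)\<^sup>2 / (2 * \<rho>\<^sup>2) + (snd z)\<^sup>2 / (2 * s\<^sup>2)"

lemma channel_log_density_measurable[measurable]:
  "channel_log_density \<kappa> \<rho> s \<in> borel_measurable (borel \<Otimes>\<^sub>M borel)"
  unfolding channel_log_density_def by measurable

lemma normal_density_mult_exp_channel_log_density:
  assumes "\<rho> > 0" "s > 0"
  shows "normal_density 0 s y * exp (channel_log_density \<kappa> \<rho> s (x, y)) = normal_density 0 \<rho> (y - \<kappa> * x)"
proof -
  have "exp (channel_log_density \<kappa> \<rho> s (x, y)) = s / \<rho> * exp (- (y - \<kappa> * x)\<^sup>2 / (2 * \<rho>\<^sup>2)) * exp (y\<^sup>2 / (2 * s\<^sup>2))"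
  proof -
    have "channel_log_density \<kappa> \<rho> s (x, y) = ln (s / \<rho>) + - (y - \<kappa> * x)\<^sup>2 / (2 * \<rho>\<^sup>2) + y\<^sup>2 / (2 * s\<^sup>2)"
      by (simp add: channel_log_density_def)
    then show ?thesis
      using assms by (simp only: exp_add) simp
  qed
  then show ?thesis
    using assms by (simp add: normal_density_def real_sqrt_mult exp_minus field_simps)
qed

text \<open>For fixed x the map w \<mapsto> \<kappa> x + w is a translation. Tonelli reduces the
  change of variables to translation invariance of Lebesgue measure, so no Jacobian factor
  appears.\<close>

lemma (in prob_space) distributed_shear:
  fixes X W :: "'a \<Rightarrow> real"
  assumes D: "distributed M (lborel \<Otimes>\<^sub>M lborel) (\<lambda>\<omega>. (X \<omega>, W \<omega>)) f"
  shows "distributed M (lborel \<Otimes>\<^sub>M lborel) (\<lambda>\<omega>. (X \<omega>, \<kappa> * X \<omega> + W \<omega>)) (\<lambda>z. f (fst z, snd z - \<kappa> * fst z))"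
  unfolding distributed_def
proof (intro conjI)
  have [measurable]: "f \<in> borel_measurable (borel \<Otimes>\<^sub>M borel)"
      "(\<lambda>\<omega>. (X \<omega>, W \<omega>)) \<in> measurable M (borel \<Otimes>\<^sub>M borel)"
    using distributed_borel_measurable[OF D] distributed_measurable[OF D]
    by (simp_all cong: measurable_cong_sets sets_pair_measure_cong)
  have [measurable]: "X \<in> borel_measurable M" "W \<in> borel_measurable M"
    using measurable_compose[OF \<open>(\<lambda>\<omega>. (X \<omega>, W \<omega>)) \<in> _\<close> measurable_fst]
      measurable_compose[OF \<open>(\<lambda>\<omega>. (X \<omega>, W \<omega>)) \<in> _\<close> measurable_snd] by simp_all
  show rv: "random_variable (lborel \<Otimes>\<^sub>M lborel) (\<lambda>\<omega>. (X \<omega>, \<kappa> * X \<omega> + W \<omega>))"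
    by measurable
  show f': "(\<lambda>z. f (fst z, snd z - \<kappa> * fst z)) \<in> borel_measurable (lborel \<Otimes>\<^sub>M lborel)"
    by measurable
  show "distr M (lborel \<Otimes>\<^sub>M lborel) (\<lambda>\<omega>. (X \<omega>, \<kappa> * X \<omega> + W \<omega>)) =
    density (lborel \<Otimes>\<^sub>M lborel) (\<lambda>z. f (fst z, snd z - \<kappa> * fst z))"
  proof (rule measure_eqI)
    fix A assume "A \<in> sets (distr M (lborel \<Otimes>\<^sub>M lborel) (\<lambda>\<omega>. (X \<omega>, \<kappa> * X \<omega> + W \<omega>)))"
    then have A: "A \<in> sets (lborel \<Otimes>\<^sub>M lborel)" by simp
    then have [measurable]: "A \<in> sets (borel \<Otimes>\<^sub>M borel)"
      by (simp cong: sets_pair_measure_cong)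
    have "emeasure (distr M (lborel \<Otimes>\<^sub>M lborel) (\<lambda>\<omega>. (X \<omega>, \<kappa> * X \<omega> + W \<omega>))) A =
        (\<integral>\<^sup>+\<omega>. indicator A (X \<omega>, \<kappa> * X \<omega> + W \<omega>) \<partial>M)"
      using A nn_integral_distr[OF rv, of "indicator A"] by simp
    also have "\<dots> = (\<integral>\<^sup>+z. f z * indicator A (fst z, \<kappa> * fst z + snd z) \<partial>(lborel \<Otimes>\<^sub>M lborel))"
      by (subst distributed_nn_integral[OF D]) (auto cong: measurable_cong_sets)
    also have "\<dots> = (\<integral>\<^sup>+x. \<integral>\<^sup>+y. f (x, y) * indicator A (x, \<kappa> * x + y) \<partial>lborel \<partial>lborel)"
      by (subst lborel.nn_integral_fst[symmetric]) auto
    also have "\<dots> = (\<integral>\<^sup>+x. \<integral>\<^sup>+y. f (x, y - \<kappa> * x) * indicator A (x, y) \<partial>lborel \<partial>lborel)"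
    proof (rule nn_integral_cong)
      fix x
      show "(\<integral>\<^sup>+y. f (x, y) * indicator A (x, \<kappa> * x + y) \<partial>lborel) =
          (\<integral>\<^sup>+y. f (x, y - \<kappa> * x) * indicator A (x, y) \<partial>lborel)"
        by (subst nn_integral_real_affine[where c=1 and t="- \<kappa> * x"]) (auto simp: algebra_simps)
    qed
    also have "\<dots> = (\<integral>\<^sup>+z. f (fst z, snd z - \<kappa> * fst z) * indicator A z \<partial>(lborel \<Otimes>\<^sub>M lborel))"
      by (subst lborel.nn_integral_fst[symmetric]) auto
    also have "\<dots> = emeasure (density (lborel \<Otimes>\<^sub>M lborel) (\<lambda>z. f (fst z, snd z - \<kappa> * fst z))) A"
      using A f' by (subst emeasure_density) auto
    finally show "emeasure (distr M (lborel \<Otimes>\<^sub>M lborel) (\<lambda>\<omega>. (X \<omega>, \<kappa> * X \<omega> + W \<omega>))) A = \<dots>" .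
  qed simp
qed

lemma (in prob_space) normal_distributed_square:
  assumes "\<sigma> > 0" and D: "distributed M lborel X (normal_density 0 \<sigma>)"
  shows "integrable M (\<lambda>\<omega>. (X \<omega>)\<^sup>2)" "expectation (\<lambda>\<omega>. (X \<omega>)\<^sup>2) = \<sigma>\<^sup>2"
proof -
  have *: "has_bochner_integral lborel (\<lambda>x. normal_density 0 \<sigma> x * x\<^sup>2) (\<sigma>\<^sup>2)"
    using normal_moment_even[of \<sigma> 0 1] assms by (simp add: eval_nat_numeral)
  show "integrable M (\<lambda>\<omega>. (X \<omega>)\<^sup>2)"
    using distributed_integrable[OF D, of "\<lambda>x. x\<^sup>2"] * by (auto simp: has_bochner_integral_iff)
  show "expectation (\<lambda>\<omega>. (X \<omega>)\<^sup>2) = \<sigma>\<^sup>2"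
    using distributed_integral[OF D, of "\<lambda>x. x\<^sup>2"] * by (auto simp: has_bochner_integral_iff)
qed

lemma abs_two_mult_le: "\<bar>2 * u * v\<bar> \<le> u\<^sup>2 + v\<^sup>2" for u v :: real
  using sum_squares_bound[of "\<bar>u\<bar>" "\<bar>v\<bar>"] by (simp add: abs_mult)

text \<open>Here X is the signal, W the noise, s the standard deviation of the output and g^2 the
  signal-to-noise ratio. All estimates are stated in g, which becomes sqrt (n a_j) in coordinate
  j.\<close>

locale gaussian_channel = prob_space M for M :: "'a measure" +
  fixes X W :: "'a \<Rightarrow> real" and \<kappa> \<tau> \<rho> s g :: real
  assumes pos: "\<kappa> > 0" "\<tau> > 0" "\<rho> > 0"
    and X: "distributed M lborel X (normal_density 0 \<tau>)"
    and W: "distributed M lborel W (normal_density 0 \<rho>)"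
    and indep: "indep_var borel X borel W"
    and s_def: "s = sqrt ((\<kappa> * \<tau>)\<^sup>2 + \<rho>\<^sup>2)"
    and g_def: "g = \<kappa> * \<tau> / \<rho>"
begin

lemma X_rv[measurable]: "random_variable borel X" and W_rv[measurable]: "random_variable borel W"
  using distributed_measurable[OF X] distributed_measurable[OF W] by simp_all

lemma g_pos: "g > 0" and s_eq: "s = \<rho> * sqrt (1 + g\<^sup>2)" and s_pos: "s > 0"
proof -
  show "g > 0" using pos by (simp add: g_def)
  have "(\<kappa> * \<tau>)\<^sup>2 + \<rho>\<^sup>2 = \<rho>\<^sup>2 * (1 + g\<^sup>2)"
    using pos by (simp add: g_def field_simps)
  then show *: "s = \<rho> * sqrt (1 + g\<^sup>2)"
    using pos by (simp add: s_def real_sqrt_mult)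
  show "s > 0"
    unfolding * using pos by (intro mult_pos_pos) (auto simp: add_pos_nonneg)
qed

text \<open>The rescaled noise has the law of the output but is independent of X, so paired with X
  it realises the product of the two marginals.\<close>

lemma normal_reference: "distributed M lborel (\<lambda>\<omega>. s / \<rho> * W \<omega>) (normal_density 0 s)"
  using normal_density_affine[OF W, of "s / \<rho>" 0] pos s_pos by simp

lemma normal_observation: "distributed M lborel (\<lambda>\<omega>. \<kappa> * X \<omega> + W \<omega>) (normal_density 0 s)"
proof -
  have "distributed M lborel (\<lambda>\<omega>. \<kappa> * X \<omega>) (normal_density 0 (\<kappa> * \<tau>))"
    using normal_density_affine[OF X, of \<kappa> 0] pos by simp
  moreover have "indep_var borel (\<lambda>\<omega>. \<kappa> * X \<omega>) borel W"
    by (rule indep_var_compose[unfolded comp_def, OF indep, of "\<lambda>x. \<kappa> * x" _ "\<lambda>x. x"]) measurable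
  ultimately show ?thesis
    using add_indep_normal[of "\<lambda>\<omega>. \<kappa> * X \<omega>" W "\<kappa> * \<tau>" \<rho> 0 0] pos W by (simp add: s_def)
qed

text \<open>Both pairs have Lebesgue densities with the common factor N(0, \<tau>^2) in x. What
  remains is the conditional density of the output over its marginal density.\<close>

lemma distr_channel:
  "distr M (borel \<Otimes>\<^sub>M borel) (\<lambda>\<omega>. (X \<omega>, \<kappa> * X \<omega> + W \<omega>)) =
   density (distr M (borel \<Otimes>\<^sub>M borel) (\<lambda>\<omega>. (X \<omega>, s / \<rho> * W \<omega>)))
     (\<lambda>z. ennreal (exp (channel_log_density \<kappa> \<rho> s z)))"
proof -
  \<comment> \<open>Densities live over \<open>lborel\<close> and independence over
    \<open>borel\<close>; the two have the same measurable sets, which is all that the transfers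
    use.\<close>
  have lborel_borel: "sets (lborel \<Otimes>\<^sub>M lborel) = sets (borel \<Otimes>\<^sub>M (borel :: real measure))"
    by (rule sets_pair_measure_cong) simp_all
  have sf: "sigma_finite_measure (lborel :: real measure)"
    by (rule lborel.sigma_finite_measure_axioms)
  have ind: "indep_var lborel X lborel V" if "indep_var borel X borel V" for V :: "'a \<Rightarrow> real"
    using that unfolding indep_var_eq by simp
  have "distributed M (lborel \<Otimes>\<^sub>M lborel) (\<lambda>\<omega>. (X \<omega>, W \<omega>)) (\<lambda>z. ennreal (normal_density 0 \<tau> (fst z) * normal_density 0 \<rho> (snd z)))"
    using distributed_joint_indep[OF sf sf X W ind[OF indep]]
    by (simp add: ennreal_mult normal_density_nonneg case_prod_unfold)
  from distributed_shear[OF this, of \<kappa>]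
  have P: "distr M (lborel \<Otimes>\<^sub>M lborel) (\<lambda>\<omega>. (X \<omega>, \<kappa> * X \<omega> + W \<omega>)) =
      density (lborel \<Otimes>\<^sub>M lborel) (\<lambda>z. normal_density 0 \<tau> (fst z) * normal_density 0 \<rho> (snd z - \<kappa> * fst z))"
    by (simp add: distributed_distr_eq_density)
  have "indep_var borel X borel (\<lambda>\<omega>. s / \<rho> * W \<omega>)"
    by (rule indep_var_compose[unfolded comp_def, OF indep, of "\<lambda>x. x" _ "\<lambda>x. s / \<rho> * x"]) measurable
  from distributed_joint_indep[OF sf sf X normal_reference ind[OF this]]
  have Q: "distr M (lborel \<Otimes>\<^sub>M lborel) (\<lambda>\<omega>. (X \<omega>, s / \<rho> * W \<omega>)) =
      density (lborel \<Otimes>\<^sub>M lborel) (\<lambda>z. normal_density 0 \<tau> (fst z) * normal_density 0 s (snd z))"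
    by (simp add: distributed_distr_eq_density ennreal_mult normal_density_nonneg case_prod_unfold)
  have "distr M (borel \<Otimes>\<^sub>M borel) (\<lambda>\<omega>. (X \<omega>, \<kappa> * X \<omega> + W \<omega>)) =
      distr M (lborel \<Otimes>\<^sub>M lborel) (\<lambda>\<omega>. (X \<omega>, \<kappa> * X \<omega> + W \<omega>))"
    by (rule distr_cong) (simp_all add: lborel_borel)
  also have "\<dots> = density (density (lborel \<Otimes>\<^sub>M lborel) (\<lambda>z. normal_density 0 \<tau> (fst z) * normal_density 0 s (snd z)))
      (\<lambda>z. ennreal (exp (channel_log_density \<kappa> \<rho> s z)))"
  proof -
    have "normal_density 0 \<tau> (fst z) * normal_density 0 s (snd z) * exp (channel_log_density \<kappa> \<rho> s z) =
        normal_density 0 \<tau> (fst z) * normal_density 0 \<rho> (snd z - \<kappa> * fst z)" for z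
      using normal_density_mult_exp_channel_log_density[OF pos(3) s_pos, of "snd z" \<kappa> "fst z"] pos
      by (simp add: mult.assoc)
    then have "ennreal (normal_density 0 \<tau> (fst z) * normal_density 0 s (snd z)) * ennreal (exp (channel_log_density \<kappa> \<rho> s z)) =
        ennreal (normal_density 0 \<tau> (fst z) * normal_density 0 \<rho> (snd z - \<kappa> * fst z))" for z
      by (simp only: normal_density_nonneg mult_nonneg_nonneg exp_ge_zero flip: ennreal_mult)
    moreover have "channel_log_density \<kappa> \<rho> s \<in> borel_measurable (lborel \<Otimes>\<^sub>M lborel)"
      by (subst measurable_cong_sets[OF lborel_borel refl]) measurable
    ultimately show ?thesis
      unfolding P by (subst density_density_eq) simp_all
  qed
  also have "\<dots> = density (distr M (borel \<Otimes>\<^sub>M borel) (\<lambda>\<omega>. (X \<omega>, s / \<rho> * W \<omega>)))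
      (\<lambda>z. ennreal (exp (channel_log_density \<kappa> \<rho> s z)))"
    unfolding Q[symmetric] by (intro arg_cong2[where f=density] distr_cong refl) (simp_all add: lborel_borel)
  finally show ?thesis .
qed

section \<open>Moments of the log-density under the joint and the reference law\<close>

lemma integrable_squares: "integrable M (\<lambda>\<omega>. (X \<omega> / \<tau>)\<^sup>2)" "integrable M (\<lambda>\<omega>. (W \<omega> / \<rho>)\<^sup>2)"
    "expectation (\<lambda>\<omega>. (X \<omega> / \<tau>)\<^sup>2) = 1" "expectation (\<lambda>\<omega>. (W \<omega> / \<rho>)\<^sup>2) = 1"
  using normal_distributed_square[OF _ X] normal_distributed_square[OF _ W] pos
  by (simp_all add: power_divide)

lemma ln_ratio: "ln (s / \<rho>) = ln (1 + g\<^sup>2) / 2" "0 \<le> ln (1 + g\<^sup>2) / 2" "ln (1 + g\<^sup>2) / 2 \<le> g\<^sup>2 / 2"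
  using pos by (simp_all add: s_eq ln_sqrt add_pos_nonneg ln_add_one_self_le_self)

text \<open>With the standardised variables u = X / \<tau> and v = W / \<rho> the output is \<rho>
  (g u + v). The terms in v^2 without a factor g cancel, and the term linear in g comes from the
  cross product u v.\<close>

lemma abs_log_density_observation_le:
  "\<bar>channel_log_density \<kappa> \<rho> s (X \<omega>, \<kappa> * X \<omega> + W \<omega>)\<bar> \<le>
     g\<^sup>2 / 2 + (g\<^sup>2 + g) / 2 * ((X \<omega> / \<tau>)\<^sup>2 + (W \<omega> / \<rho>)\<^sup>2)"
proof -
  define u v where "u = X \<omega> / \<tau>" and "v = W \<omega> / \<rho>"
  have eq: "\<kappa> * X \<omega> + W \<omega> = \<rho> * (g * u + v)" "\<rho> * (g * u + v) - \<kappa> * X \<omega> = \<rho> * v"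
    using pos by (simp_all add: u_def v_def g_def field_simps)
  have g2: "1 + g\<^sup>2 > 0" by (simp add: add_pos_nonneg)
  have "channel_log_density \<kappa> \<rho> s (X \<omega>, \<kappa> * X \<omega> + W \<omega>) = ln (1 + g\<^sup>2) / 2 - v\<^sup>2 / 2 + (g * u + v)\<^sup>2 / (2 * (1 + g\<^sup>2))"
    using pos g2 unfolding channel_log_density_def ln_ratio fst_conv snd_conv eq
    by (simp add: s_eq power_mult_distrib)
  \<comment> \<open>Over the common denominator, - (1 + g^2) v^2 + (g u + v)^2 loses its bare
    v^2.\<close>
  also have "\<dots> = ln (1 + g\<^sup>2) / 2 + (g\<^sup>2 * u\<^sup>2 + g * (2 * u * v) - g\<^sup>2 * v\<^sup>2) / (2 * (1 + g\<^sup>2))"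
    using g2 by (simp add: field_simps power2_eq_square)
  finally have *: "channel_log_density \<kappa> \<rho> s (X \<omega>, \<kappa> * X \<omega> + W \<omega>) = \<dots>" .
  have "\<bar>g\<^sup>2 * u\<^sup>2 + g * (2 * u * v) - g\<^sup>2 * v\<^sup>2\<bar> \<le> g\<^sup>2 * u\<^sup>2 + g * (u\<^sup>2 + v\<^sup>2) + g\<^sup>2 * v\<^sup>2"
  proof -
    have "\<bar>g * (2 * u * v)\<bar> \<le> g * (u\<^sup>2 + v\<^sup>2)"
      using g_pos abs_two_mult_le[of u v] by (simp add: abs_mult[of g] mult_left_mono)
    moreover have "g\<^sup>2 * u\<^sup>2 \<ge> 0" "g\<^sup>2 * v\<^sup>2 \<ge> 0" by simp_all
    ultimately show ?thesis by linarith
  qed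
  then have "\<bar>(g\<^sup>2 * u\<^sup>2 + g * (2 * u * v) - g\<^sup>2 * v\<^sup>2) / (2 * (1 + g\<^sup>2))\<bar>
      \<le> (g\<^sup>2 * u\<^sup>2 + g * (u\<^sup>2 + v\<^sup>2) + g\<^sup>2 * v\<^sup>2) / 2"
    using g2 g_pos unfolding abs_divide by (intro frac_le) (auto intro!: add_nonneg_nonneg)
  also have "\<dots> = (g\<^sup>2 + g) / 2 * (u\<^sup>2 + v\<^sup>2)"
    by (simp add: field_simps)
  finally show ?thesis
    using ln_ratio(2,3) unfolding * u_def[symmetric] v_def[symmetric] by linarith
qed

text \<open>The same cancellation with q = s / \<rho> = sqrt (1 + g^2): since q^2 - 1 = g^2, only
  terms with g^2 or g q remain, and q \<le> 1 + g turns g q into g + g^2. This is the origin of the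
  coefficient 2 g^2 + g.\<close>

lemma abs_log_density_reference_le:
  "\<bar>channel_log_density \<kappa> \<rho> s (X \<omega>, s / \<rho> * W \<omega>)\<bar> \<le>
     g\<^sup>2 / 2 + (2 * g\<^sup>2 + g) / 2 * ((X \<omega> / \<tau>)\<^sup>2 + (W \<omega> / \<rho>)\<^sup>2)"
proof -
  define u v q where "u = X \<omega> / \<tau>" and "v = W \<omega> / \<rho>" and "q = sqrt (1 + g\<^sup>2)"
  have eq: "s / \<rho> * W \<omega> = \<rho> * (q * v)" "s = \<rho> * q" "\<kappa> * X \<omega> = \<rho> * (g * u)"
    using pos by (simp_all add: u_def v_def g_def q_def s_eq field_simps)
  have q: "q > 0" "q\<^sup>2 = 1 + g\<^sup>2" "q \<le> 1 + g"
  proof -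
    show "q > 0" "q\<^sup>2 = 1 + g\<^sup>2" by (simp_all add: q_def add_pos_nonneg)
    show "q \<le> 1 + g"
      unfolding q_def using g_pos by (intro real_le_lsqrt) (auto simp: power2_eq_square algebra_simps)
  qed
  have "channel_log_density \<kappa> \<rho> s (X \<omega>, s / \<rho> * W \<omega>) = ln (1 + g\<^sup>2) / 2 - (q * v - g * u)\<^sup>2 / 2 + v\<^sup>2 / 2"
  proof -
    have "\<rho> * (q * v) - \<rho> * (g * u) = \<rho> * (q * v - g * u)" by (simp add: algebra_simps)
    then show ?thesis
      using pos q(1) unfolding channel_log_density_def ln_ratio fst_conv snd_conv eq(1,3)
      by (simp add: eq(2) power_mult_distrib)
  qed
  also have "\<dots> = ln (1 + g\<^sup>2) / 2 + (- (g\<^sup>2 * v\<^sup>2) + g * q * (2 * u * v) - g\<^sup>2 * u\<^sup>2) / 2"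
  proof -
    have "(q * v - g * u)\<^sup>2 = (1 + g\<^sup>2) * v\<^sup>2 - g * q * (2 * u * v) + g\<^sup>2 * u\<^sup>2"
      unfolding q(2)[symmetric] by (simp add: power2_eq_square algebra_simps)
    then show ?thesis by (simp add: field_simps)
  qed
  finally have *: "channel_log_density \<kappa> \<rho> s (X \<omega>, s / \<rho> * W \<omega>) = \<dots>" .
  have "\<bar>- (g\<^sup>2 * v\<^sup>2) + g * q * (2 * u * v) - g\<^sup>2 * u\<^sup>2\<bar> \<le> g\<^sup>2 * v\<^sup>2 + (g + g\<^sup>2) * (u\<^sup>2 + v\<^sup>2) + g\<^sup>2 * u\<^sup>2"
  proof -
    have "g * q \<le> g * (1 + g)"
      using q g_pos by (intro mult_left_mono) auto
    then have "g * q * \<bar>2 * u * v\<bar> \<le> (g + g\<^sup>2) * (u\<^sup>2 + v\<^sup>2)"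
      using q g_pos abs_two_mult_le[of u v]
      by (intro mult_mono) (auto simp: power2_eq_square algebra_simps)
    moreover have "\<bar>g * q * (2 * u * v)\<bar> = g * q * \<bar>2 * u * v\<bar>"
      using q g_pos by (simp only: abs_mult[of "g * q"]) (simp add: abs_mult)
    moreover have "g\<^sup>2 * u\<^sup>2 \<ge> 0" "g\<^sup>2 * v\<^sup>2 \<ge> 0" by simp_all
    ultimately show ?thesis by linarith
  qed
  also have "g\<^sup>2 * v\<^sup>2 + (g + g\<^sup>2) * (u\<^sup>2 + v\<^sup>2) + g\<^sup>2 * u\<^sup>2 = 2 * ((2 * g\<^sup>2 + g) / 2 * (u\<^sup>2 + v\<^sup>2))"
    by (simp add: algebra_simps)
  finally have "\<bar>ln (1 + g\<^sup>2) / 2 + N / 2\<bar> \<le> g\<^sup>2 / 2 + Z"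
    if "N = - (g\<^sup>2 * v\<^sup>2) + g * q * (2 * u * v) - g\<^sup>2 * u\<^sup>2" "Z = (2 * g\<^sup>2 + g) / 2 * (u\<^sup>2 + v\<^sup>2)" for N Z
    using ln_ratio(2,3) unfolding that[symmetric] by linarith
  then show ?thesis
    unfolding * u_def[symmetric] v_def[symmetric] by blast
qed

text \<open>Both standardised squares have mean 1, so the pointwise bound integrates to 3/2 g^2 + g,
  and the one for the reference law to 5/2 g^2 + g; 3 (g^2 + g) covers both.\<close>

lemma integrable_log_density_observation:
    "integrable M (\<lambda>\<omega>. channel_log_density \<kappa> \<rho> s (X \<omega>, \<kappa> * X \<omega> + W \<omega>))" (is "integrable M ?l")
  and expectation_abs_log_density_observation_le:
    "expectation (\<lambda>\<omega>. \<bar>channel_log_density \<kappa> \<rho> s (X \<omega>, \<kappa> * X \<omega> + W \<omega>)\<bar>) \<le> 3 * (g\<^sup>2 + g)"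
proof -
  let ?B = "\<lambda>\<omega>. g\<^sup>2 / 2 + (g\<^sup>2 + g) / 2 * ((X \<omega> / \<tau>)\<^sup>2 + (W \<omega> / \<rho>)\<^sup>2)"
  have B: "integrable M ?B"
    using integrable_squares by simp
  then show int: "integrable M ?l"
  proof (rule Bochner_Integration.integrable_bound)
    show "AE \<omega> in M. norm (?l \<omega>) \<le> norm (?B \<omega>)"
      unfolding real_norm_def
      by (intro AE_I2 order_trans[OF abs_log_density_observation_le abs_ge_self])
  qed measurable
  have "expectation (\<lambda>\<omega>. \<bar>?l \<omega>\<bar>) \<le> expectation ?B"
    using int B abs_log_density_observation_le by (intro integral_mono) auto
  also have "\<dots> = g\<^sup>2 / 2 + (g\<^sup>2 + g) / 2 * (1 + 1)"
    using integrable_squares by (simp add: prob_space)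
  also have "\<dots> \<le> 3 * (g\<^sup>2 + g)"
    using g_pos by (simp add: field_simps)
  finally show "expectation (\<lambda>\<omega>. \<bar>?l \<omega>\<bar>) \<le> 3 * (g\<^sup>2 + g)" .
qed

lemma integrable_log_density_reference:
    "integrable M (\<lambda>\<omega>. channel_log_density \<kappa> \<rho> s (X \<omega>, s / \<rho> * W \<omega>))" (is "integrable M ?l")
  and expectation_abs_log_density_reference_le:
    "expectation (\<lambda>\<omega>. \<bar>channel_log_density \<kappa> \<rho> s (X \<omega>, s / \<rho> * W \<omega>)\<bar>) \<le> 3 * (g\<^sup>2 + g)"
proof -
  let ?B = "\<lambda>\<omega>. g\<^sup>2 / 2 + (2 * g\<^sup>2 + g) / 2 * ((X \<omega> / \<tau>)\<^sup>2 + (W \<omega> / \<rho>)\<^sup>2)"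
  have B: "integrable M ?B"
    using integrable_squares by simp
  then show int: "integrable M ?l"
  proof (rule Bochner_Integration.integrable_bound)
    show "AE \<omega> in M. norm (?l \<omega>) \<le> norm (?B \<omega>)"
      unfolding real_norm_def
      by (intro AE_I2 order_trans[OF abs_log_density_reference_le abs_ge_self])
  qed measurable
  have "expectation (\<lambda>\<omega>. \<bar>?l \<omega>\<bar>) \<le> expectation ?B"
    using int B abs_log_density_reference_le by (intro integral_mono) auto
  also have "\<dots> = g\<^sup>2 / 2 + (2 * g\<^sup>2 + g) / 2 * (1 + 1)"
    using integrable_squares by (simp add: prob_space)
  also have "\<dots> \<le> 3 * (g\<^sup>2 + g)"
    using g_pos by (simp add: field_simps)
  finally show "expectation (\<lambda>\<omega>. \<bar>?l \<omega>\<bar>) \<le> 3 * (g\<^sup>2 + g)" .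
qed

text \<open>The two quadratic terms have mean 1/2 each and cancel, leaving ln (s / \<rho>), half the
  logarithm of one plus the signal-to-noise ratio.\<close>

lemma expectation_log_density_observation:
  "expectation (\<lambda>\<omega>. channel_log_density \<kappa> \<rho> s (X \<omega>, \<kappa> * X \<omega> + W \<omega>)) = ln (1 + g\<^sup>2) / 2"
  using normal_distributed_square[OF s_pos normal_observation] normal_distributed_square[OF _ W] pos s_pos
  by (simp add: channel_log_density_def ln_ratio prob_space)

end

section \<open>Mutual information of the sequence experiment\<close>

context gaussian_sequence_experiment
begin

section \<open>Independence regrouped by coordinate and by sequence\<close>

lemma \<theta>_rv[measurable]: "j \<ge> 1 \<Longrightarrow> random_variable borel (\<theta> j)"
  and \<epsilon>_rv[measurable]: "j \<ge> 1 \<Longrightarrow> random_variable borel (\<epsilon> j)"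
  using distributed_measurable[OF \<theta>_normal] distributed_measurable[OF \<epsilon>_normal] by simp_all

text \<open>The blocks {Inl j, Inr j} are disjoint, and functions of disjoint blocks of an
  independent family are independent. A free f serves the observations, the rescaled noises and the
  pairs of either with the signal.\<close>

lemma indep_vars_coordinate_pairs:
  assumes f: "\<And>j. f j \<in> measurable (borel \<Otimes>\<^sub>M borel) N"
  shows "indep_vars (\<lambda>_. N) (\<lambda>j \<omega>. f j (\<theta> j \<omega>, \<epsilon> j \<omega>)) {1..}"
proof -
  have "indep_vars (\<lambda>j. PiM {Inl j, Inr j} (\<lambda>_. borel))
      (\<lambda>j \<omega>. restrict (\<lambda>i. case_sum \<theta> \<epsilon> i \<omega>) {Inl j, Inr j}) {1..}"
    by (rule indep_vars_restrict[OF indep]) (auto simp: disjoint_family_on_def)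
  then have "indep_vars (\<lambda>_. N)
      (\<lambda>j \<omega>. (\<lambda>x. f j (x (Inl j), x (Inr j))) (restrict (\<lambda>i. case_sum \<theta> \<epsilon> i \<omega>) {Inl j, Inr j})) {1..}"
  proof (rule indep_vars_compose2)
    fix j :: nat
    show "(\<lambda>x. f j (x (Inl j), x (Inr j))) \<in> measurable (PiM {Inl j, Inr j} (\<lambda>_. borel)) N"
      by (rule measurable_compose[OF _ f]) measurable
  qed
  then show ?thesis by simp
qed

lemma indep_var_coordinate:
  assumes "j \<ge> 1"
  shows "indep_var borel (\<theta> j) borel (\<epsilon> j)"
proof -
  have "indep_var (PiM {Inl j} (\<lambda>_. borel)) (\<lambda>\<omega>. restrict (\<lambda>i. case_sum \<theta> \<epsilon> i \<omega>) {Inl j})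
      (PiM {Inr j} (\<lambda>_. borel)) (\<lambda>\<omega>. restrict (\<lambda>i. case_sum \<theta> \<epsilon> i \<omega>) {Inr j})"
    using assms by (intro indep_var_restrict[OF indep]) auto
  from indep_var_compose[unfolded comp_def, OF this, of "\<lambda>x. x (Inl j)" borel "\<lambda>x. x (Inr j)" borel]
  show ?thesis by simp
qed

text \<open>Now the blocks are all of the left and all of the right summand, so independence holds
  between entire sequences. The weights c leave room for rescaling the noise coordinatewise.\<close>

lemma indep_var_sequences:
  "indep_var seq_space (random_seq \<theta>) seq_space (random_seq (\<lambda>j \<omega>. c j * \<epsilon> j \<omega>))"
proof -
  have "indep_var (PiM (Inl ` {1..}) (\<lambda>_. borel)) (\<lambda>\<omega>. restrict (\<lambda>i. case_sum \<theta> \<epsilon> i \<omega>) (Inl ` {1..}))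
      (PiM (Inr ` {1..}) (\<lambda>_. borel)) (\<lambda>\<omega>. restrict (\<lambda>i. case_sum \<theta> \<epsilon> i \<omega>) (Inr ` {1..}))"
    by (rule indep_var_restrict[OF indep]) auto
  then have "indep_var seq_space ((\<lambda>x. \<lambda>j\<in>{1..}. x (Inl j)) \<circ> (\<lambda>\<omega>. restrict (\<lambda>i. case_sum \<theta> \<epsilon> i \<omega>) (Inl ` {1..})))
      seq_space ((\<lambda>x. \<lambda>j\<in>{1..}. c j * x (Inr j)) \<circ> (\<lambda>\<omega>. restrict (\<lambda>i. case_sum \<theta> \<epsilon> i \<omega>) (Inr ` {1..})))"
    by (rule indep_var_compose) (auto intro!: measurable_restrict borel_measurable_times measurable_component_singleton)
  then show ?thesis
    by (simp add: comp_def random_seq_def[abs_def] cong: restrict_cong)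
qed

lemma random_seq_measurable:
  assumes "\<And>j. j \<ge> 1 \<Longrightarrow> random_variable borel (X j)"
  shows "random_variable seq_space (random_seq X)"
  unfolding random_seq_def[abs_def] using assms by (intro measurable_restrict) auto

text \<open>
  The product of the marginal laws is realised on the given probability space as the law of \<open>\<theta>\<close>
  together with a rescaled copy of the noise, which has the same law as the observation but is
  independent of \<open>\<theta>\<close>.
\<close>

lemma two_mutual_info:
  assumes n: "n > 0"
    and a: "\<And>j. j \<ge> 1 \<Longrightarrow> a j = (\<kappa> j)\<^sup>2 * (\<tau> j)\<^sup>2 / \<sigma>\<^sup>2"
    and sum1: "summable (\<lambda>k. a (Suc k))"
    and sum2: "summable (\<lambda>k. sqrt (a (Suc k)))"
  shows "2 * mutual_info M \<theta> \<epsilon> \<kappa> n = (\<Sum>k. ln (1 + n * a (Suc k)))"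
proof -
  \<comment> \<open>\<open>r\<close> is the noise level, \<rho> the standard deviation of the scaled
    noise and \<open>s j\<close> that of the j-th observation.\<close>
  define r where "r = n powr (- 1 / 2)"
  define \<rho> where "\<rho> = r * \<sigma>"
  define s where "s = (\<lambda>j. sqrt ((\<kappa> j * \<tau> j)\<^sup>2 + \<rho>\<^sup>2))"
  define g where "g = (\<lambda>j. \<kappa> j * \<tau> j / \<rho>)"
  define l where "l = (\<lambda>j. channel_log_density (\<kappa> j) \<rho> (s j))"
  define Y where "Y = observation \<kappa> \<theta> \<epsilon> n"
  \<comment> \<open>The scaled noise has standard deviation \<rho>; the factor
    \<open>s j / \<rho>\<close> raises it to that of the observation.\<close>
  define Y' where "Y' = (\<lambda>j \<omega>. s j / \<rho> * r * \<epsilon> j \<omega>)"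
  have r: "r > 0" "r\<^sup>2 = 1 / n"
    using n by (simp_all add: r_def power2_eq_square powr_minus_divide flip: powr_add)
  have \<rho>: "\<rho> > 0" using r \<sigma>_pos by (simp add: \<rho>_def)
  have Y_eq: "Y j \<omega> = \<kappa> j * \<theta> j \<omega> + r * \<epsilon> j \<omega>" for j \<omega>
    by (simp add: Y_def observation_def r_def)
  have g2: "(g j)\<^sup>2 = n * a j" "g j = sqrt n * sqrt (a j)" if "j \<ge> 1" for j
  proof -
    show *: "(g j)\<^sup>2 = n * a j"
      using that r(2) n \<rho> by (simp add: g_def \<rho>_def a power_mult_distrib power_divide)
    have "g j \<ge> 0" using that \<kappa>_pos[OF that] \<tau>_pos[OF that] \<rho> by (simp add: g_def)
    then have "g j = sqrt ((g j)\<^sup>2)" by simp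
    then show "g j = sqrt n * sqrt (a j)" by (simp add: * real_sqrt_mult)
  qed
  have channel: "gaussian_channel M (\<theta> j) (\<lambda>\<omega>. r * \<epsilon> j \<omega>) (\<kappa> j) (\<tau> j) \<rho> (s j) (g j)" if j: "j \<ge> 1" for j
  proof
    show "distributed M lborel (\<lambda>\<omega>. r * \<epsilon> j \<omega>) (normal_density 0 \<rho>)"
      using normal_density_affine[OF \<epsilon>_normal[OF j] \<sigma>_pos, of r 0] r by (simp add: \<rho>_def)
    show "indep_var borel (\<theta> j) borel (\<lambda>\<omega>. r * \<epsilon> j \<omega>)"
      by (rule indep_var_compose[unfolded comp_def, OF indep_var_coordinate[OF j], of "\<lambda>x. x" _ "\<lambda>x. r * x"]) measurable
  qed (use j \<kappa>_pos \<tau>_pos \<rho> \<theta>_normal in \<open>auto simp: s_def g_def\<close>)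
  have Y_rv: "random_variable borel (Y j)" and Y'_rv: "random_variable borel (Y' j)" if "j \<ge> 1" for j
    using that by (simp_all add: Y_eq[abs_def] Y'_def)
  define ZP where "ZP = (\<lambda>j \<omega>. (\<theta> j \<omega>, Y j \<omega>))"
  define ZQ where "ZQ = (\<lambda>j \<omega>. (\<theta> j \<omega>, Y' j \<omega>))"
  define B where "B = (borel \<Otimes>\<^sub>M borel :: (real \<times> real) measure)"
  have l_meas[measurable]: "l j \<in> borel_measurable B" for j
    by (simp add: l_def B_def)
  have ZP_rv: "random_variable B (ZP j)" and ZQ_rv: "random_variable B (ZQ j)" if "j \<ge> 1" for j
    using that Y_rv Y'_rv by (simp_all add: ZP_def ZQ_def B_def)
  have distr_ZP: "distr M B (ZP j) = density (distr M B (ZQ j)) (\<lambda>z. ennreal (exp (l j z)))" if "j \<ge> 1" for j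
    using gaussian_channel.distr_channel[OF channel[OF that]]
    by (simp add: B_def ZP_def ZQ_def l_def Y_eq Y'_def mult.assoc)
  define \<Omega> where "\<Omega> = PiM {1::nat..} (\<lambda>_. B)"
  have PiM_ZP: "distr M \<Omega> (\<lambda>\<omega>. \<lambda>j\<in>{1..}. ZP j \<omega>) = PiM {1..} (\<lambda>j. distr M B (ZP j))"
  proof -
    have "indep_vars (\<lambda>_. B) (\<lambda>j \<omega>. (\<lambda>z. (fst z, \<kappa> j * fst z + r * snd z)) (\<theta> j \<omega>, \<epsilon> j \<omega>)) {1..}"
      by (rule indep_vars_coordinate_pairs) (simp add: B_def)
    then have "indep_vars (\<lambda>_. B) ZP {1..}"
      by (simp add: ZP_def Y_eq[abs_def])
    then show ?thesis
      unfolding \<Omega>_def by (subst (asm) indep_vars_iff_distr_eq_PiM') (auto simp: ZP_rv)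
  qed
  have PiM_ZQ: "distr M \<Omega> (\<lambda>\<omega>. \<lambda>j\<in>{1..}. ZQ j \<omega>) = PiM {1..} (\<lambda>j. distr M B (ZQ j))"
  proof -
    have "indep_vars (\<lambda>_. B) (\<lambda>j \<omega>. (\<lambda>z. (fst z, s j / \<rho> * r * snd z)) (\<theta> j \<omega>, \<epsilon> j \<omega>)) {1..}"
      by (rule indep_vars_coordinate_pairs) (simp add: B_def)
    then have "indep_vars (\<lambda>_. B) ZQ {1..}"
      by (simp add: ZQ_def Y'_def)
    then show ?thesis
      unfolding \<Omega>_def by (subst (asm) indep_vars_iff_distr_eq_PiM') (auto simp: ZQ_rv)
  qed
  have distr_Y: "distr M seq_space (random_seq Y) = distr M seq_space (random_seq Y')"
  proof -
    have "indep_vars (\<lambda>_. borel) (\<lambda>j \<omega>. (\<lambda>z. \<kappa> j * fst z + r * snd z) (\<theta> j \<omega>, \<epsilon> j \<omega>)) {1..}"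
      by (rule indep_vars_coordinate_pairs) measurable
    then have 1: "indep_vars (\<lambda>_. borel) Y {1..}"
      by (simp add: Y_eq[abs_def])
    have "indep_vars (\<lambda>_. borel) (\<lambda>j \<omega>. (\<lambda>z. s j / \<rho> * r * snd z) (\<theta> j \<omega>, \<epsilon> j \<omega>)) {1..}"
      by (rule indep_vars_coordinate_pairs) measurable
    then have 2: "indep_vars (\<lambda>_. borel) Y' {1..}"
      by (simp add: Y'_def)
    have marginal: "distr M borel (Y j) = distr M borel (Y' j)" if j: "j \<ge> 1" for j
    proof -
      have "distr M lborel (Y j) = distr M lborel (Y' j)"
        using gaussian_channel.normal_observation[OF channel[OF j]] gaussian_channel.normal_reference[OF channel[OF j]]
        by (simp add: distributed_distr_eq_density Y_eq[abs_def] Y'_def mult.assoc)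
      moreover have "distr M borel Z = distr M lborel Z" for Z :: "'a \<Rightarrow> real"
        by (rule distr_cong) simp_all
      ultimately show ?thesis by simp
    qed
    have law: "distr M seq_space (random_seq Z) = PiM {1..} (\<lambda>j. distr M borel (Z j))"
      if "indep_vars (\<lambda>_. borel) Z {1..}" "\<And>j. j \<ge> 1 \<Longrightarrow> random_variable borel (Z j)" for Z
      unfolding random_seq_def[abs_def] using that
      by (subst (asm) indep_vars_iff_distr_eq_PiM') auto
    have "distr M seq_space (random_seq Y) = PiM {1..} (\<lambda>j. distr M borel (Y j))"
      using 1 Y_rv by (rule law)
    also have "\<dots> = PiM {1..} (\<lambda>j. distr M borel (Y' j))"
      by (intro PiM_cong refl marginal) simp
    also have "\<dots> = distr M seq_space (random_seq Y')"
      using 2 Y'_rv by (rule law[symmetric])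
    finally show ?thesis .
  qed
  have \<theta>_seq: "random_variable seq_space (random_seq \<theta>)"
    and Y_seq: "random_variable seq_space (random_seq Y)"
    and Y'_seq: "random_variable seq_space (random_seq Y')"
    by (intro random_seq_measurable \<theta>_rv Y_rv Y'_rv; assumption)+
  define P where "P = distr M (seq_space \<Otimes>\<^sub>M seq_space) (\<lambda>\<omega>. (random_seq \<theta> \<omega>, random_seq Y \<omega>))"
  define Q where "Q = distr M seq_space (random_seq \<theta>) \<Otimes>\<^sub>M distr M seq_space (random_seq Y)"
  \<comment> \<open>\<open>Y\<close> may be replaced by \<open>Y'\<close> because their sequence
    laws agree, and then independence of \<open>Y'\<close> from the signal turns the product of laws
    into a joint law.\<close>
  have Q_eq: "Q = distr M (seq_space \<Otimes>\<^sub>M seq_space) (\<lambda>\<omega>. (random_seq \<theta> \<omega>, random_seq Y' \<omega>))"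
    using indep_var_sequences[of "\<lambda>j. s j / \<rho> * r"] unfolding indep_var_distribution_eq Q_def distr_Y Y'_def
    by (simp add: mult.assoc)
  \<comment> \<open>As an exponential, \<open>h\<close> is positive everywhere, whatever value the
    series takes where it fails to converge.\<close>
  define h where "h = (\<lambda>z. exp (\<Sum>k. l (Suc k) (z (Suc k))))"
  have h_pos: "h z > 0" for z
    by (simp add: h_def)
  have coord[measurable]: "(\<lambda>z. z (Suc k)) \<in> measurable \<Omega> B" for k
    unfolding \<Omega>_def by measurable
  have h_meas[measurable]: "h \<in> borel_measurable \<Omega>"
    unfolding h_def by measurable
  have moments: "integrable (distr M B (ZQ j)) (l j)" "integrable (distr M B (ZP j)) (l j)"
      "(\<integral>z. \<bar>l j z\<bar> \<partial>distr M B (ZQ j)) \<le> 3 * ((g j)\<^sup>2 + g j)"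
      "(\<integral>z. \<bar>l j z\<bar> \<partial>distr M B (ZP j)) \<le> 3 * ((g j)\<^sup>2 + g j)" if j: "j \<ge> 1" for j
    using gaussian_channel.integrable_log_density_observation[OF channel[OF j]]
      gaussian_channel.integrable_log_density_reference[OF channel[OF j]]
      gaussian_channel.expectation_abs_log_density_observation_le[OF channel[OF j]]
      gaussian_channel.expectation_abs_log_density_reference_le[OF channel[OF j]]
    by (simp_all add: integrable_distr_eq integral_distr ZP_rv[OF j] ZQ_rv[OF j])
      (simp_all add: ZP_def ZQ_def l_def Y_eq Y'_def mult.assoc)
  \<comment> \<open>For fixed n the moment bounds are multiples of n a_j + sqrt n sqrt a_j, which is
    where summability of sqrt a_j enters.\<close>
  have g_sum: "summable (\<lambda>k. 3 * ((g (Suc k))\<^sup>2 + g (Suc k)))"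
  proof -
    have "(g (Suc k))\<^sup>2 + g (Suc k) = n * a (Suc k) + sqrt n * sqrt (a (Suc k))" for k
      by (rule arg_cong2[where f="(+)"]; rule g2) simp_all
    then show ?thesis
      using sum1 sum2 by (simp only:) (intro summable_mult summable_add)
  qed
  have sums: "summable (\<lambda>k. \<integral>z. \<bar>l (Suc k) z\<bar> \<partial>distr M B (ZQ (Suc k)))"
      "summable (\<lambda>k. \<integral>z. \<bar>l (Suc k) z\<bar> \<partial>distr M B (ZP (Suc k)))"
    by (rule summable_comparison_test'[OF g_sum, of 0]; use moments(3,4) in \<open>simp add: integral_nonneg_AE\<close>)+
  have Pi_density: "distr M \<Omega> (\<lambda>\<omega>. \<lambda>j\<in>{1..}. ZP j \<omega>) = density (distr M \<Omega> (\<lambda>\<omega>. \<lambda>j\<in>{1..}. ZQ j \<omega>)) (\<lambda>z. ennreal (h z))"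
  proof -
    have "PiM {1..} (\<lambda>j. distr M B (ZP j)) = PiM {1..} (\<lambda>j. density (distr M B (ZQ j)) (\<lambda>z. ennreal (exp (l j z))))"
      by (intro PiM_cong refl distr_ZP) simp
    also have "\<dots> = density (PiM {1..} (\<lambda>j. distr M B (ZQ j))) (\<lambda>z. ennreal (exp (\<Sum>k. l (Suc k) (z (Suc k)))))"
    proof (rule PiM_density_exp)
      show "bij_betw Suc UNIV {1..}"
        by (auto simp: bij_betw_def image_iff Suc_le_eq gr0_conv_Suc)
    qed (use moments sums in \<open>auto simp: prob_space_distr ZP_rv ZQ_rv simp flip: distr_ZP\<close>)
    finally show ?thesis
      unfolding PiM_ZP PiM_ZQ h_def .
  qed
  \<comment> \<open>The product density lives on sequences of pairs, the mutual information on pairs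
    of sequences; \<phi> and \<psi> translate between the two.\<close>
  define \<phi> where "\<phi> = (\<lambda>(x, y). \<lambda>j\<in>{1::nat..}. (x j :: real, y j :: real))"
  define \<psi> where "\<psi> = (\<lambda>z :: nat \<Rightarrow> real \<times> real. (\<lambda>j\<in>{1::nat..}. fst (z j), \<lambda>j\<in>{1::nat..}. snd (z j)))"
  have \<phi>[measurable]: "\<phi> \<in> measurable (seq_space \<Otimes>\<^sub>M seq_space) \<Omega>"
    unfolding \<phi>_def \<Omega>_def B_def case_prod_unfold by (intro measurable_restrict) measurable
  have \<psi>[measurable]: "\<psi> \<in> measurable \<Omega> (seq_space \<Otimes>\<^sub>M seq_space)"
    unfolding \<psi>_def \<Omega>_def B_def by (intro measurable_Pair measurable_restrict) measurable
  have ZP_seq[measurable]: "(\<lambda>\<omega>. \<lambda>j\<in>{1..}. ZP j \<omega>) \<in> measurable M \<Omega>"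
    and ZQ_seq[measurable]: "(\<lambda>\<omega>. \<lambda>j\<in>{1..}. ZQ j \<omega>) \<in> measurable M \<Omega>"
    unfolding \<Omega>_def by (auto intro!: measurable_restrict ZP_rv ZQ_rv)
  have \<psi>_ZP: "\<psi> (\<lambda>j\<in>{1..}. ZP j \<omega>) = (random_seq \<theta> \<omega>, random_seq Y \<omega>)"
    and \<psi>_ZQ: "\<psi> (\<lambda>j\<in>{1..}. ZQ j \<omega>) = (random_seq \<theta> \<omega>, random_seq Y' \<omega>)"
    and \<phi>_P: "\<phi> (random_seq \<theta> \<omega>, random_seq Y \<omega>) = (\<lambda>j\<in>{1..}. ZP j \<omega>)"
    and \<phi>_Q: "\<phi> (random_seq \<theta> \<omega>, random_seq Y' \<omega>) = (\<lambda>j\<in>{1..}. ZQ j \<omega>)" for \<omega>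
    by (auto simp: \<psi>_def \<phi>_def random_seq_def ZP_def ZQ_def fun_eq_iff)
  have pair_meas: "(\<lambda>\<omega>. (random_seq \<theta> \<omega>, random_seq Y \<omega>)) \<in> measurable M (seq_space \<Otimes>\<^sub>M seq_space)"
    "(\<lambda>\<omega>. (random_seq \<theta> \<omega>, random_seq Y' \<omega>)) \<in> measurable M (seq_space \<Otimes>\<^sub>M seq_space)"
    using \<theta>_seq Y_seq Y'_seq by (auto intro: measurable_Pair)
  have h\<phi>_meas': "(\<lambda>z. h (\<phi> z)) \<in> borel_measurable (seq_space \<Otimes>\<^sub>M seq_space)"
    by measurable
  then have h\<phi>_meas: "(\<lambda>z. h (\<phi> z)) \<in> borel_measurable Q"
    unfolding Q_eq by (simp del: One_nat_def)
  have P_density: "P = density Q (\<lambda>z. ennreal (h (\<phi> z)))"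
  proof -
    \<comment> \<open>The density is pulled back to \<open>M\<close> and pushed to sequences of
      pairs, where it turns the law of \<open>ZQ\<close> into that of \<open>ZP\<close>; \<psi> then
      yields \<open>P\<close>.\<close>
    have "density Q (\<lambda>z. ennreal (h (\<phi> z))) =
        distr (density M (\<lambda>\<omega>. ennreal (h (\<lambda>j\<in>{1..}. ZQ j \<omega>)))) (seq_space \<Otimes>\<^sub>M seq_space)
          (\<lambda>\<omega>. (random_seq \<theta> \<omega>, random_seq Y' \<omega>))"
      unfolding Q_eq using h\<phi>_meas' by (subst density_distr) (simp_all add: pair_meas \<phi>_Q del: One_nat_def)
    also have "\<dots> = distr (distr (density M (\<lambda>\<omega>. ennreal (h (\<lambda>j\<in>{1..}. ZQ j \<omega>)))) \<Omega> (\<lambda>\<omega>. \<lambda>j\<in>{1..}. ZQ j \<omega>))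
          (seq_space \<Otimes>\<^sub>M seq_space) \<psi>"
      by (subst distr_distr) (simp_all add: comp_def \<psi>_ZQ del: One_nat_def)
    also have "distr (density M (\<lambda>\<omega>. ennreal (h (\<lambda>j\<in>{1..}. ZQ j \<omega>)))) \<Omega> (\<lambda>\<omega>. \<lambda>j\<in>{1..}. ZQ j \<omega>) =
        distr M \<Omega> (\<lambda>\<omega>. \<lambda>j\<in>{1..}. ZP j \<omega>)"
      unfolding Pi_density by (subst density_distr) (simp_all del: One_nat_def)
    also have "distr \<dots> (seq_space \<Otimes>\<^sub>M seq_space) \<psi> = P"
      unfolding P_def by (subst distr_distr) (simp_all add: comp_def \<psi>_ZP del: One_nat_def)
    finally show ?thesis ..
  qed
  interpret Q: prob_space Q
    unfolding Q_eq by (rule prob_space_distr) (rule pair_meas)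
  have "mutual_info M \<theta> \<epsilon> \<kappa> n = KL_divergence (exp 1) Q P"
    by (simp add: mutual_info_def mutual_information_def P_def Q_def Y_def)
  also have "\<dots> = (\<integral>z. h (\<phi> z) * log (exp 1) (h (\<phi> z)) \<partial>Q)"
    unfolding P_density using h\<phi>_meas by (intro Q.KL_density) (simp_all add: less_imp_le h_pos)
  \<comment> \<open>The factor \<open>h\<close> is absorbed into the measure, so the information
    becomes the mean of the log-density under the joint law and the series can be integrated
    termwise.\<close>
  also have "\<dots> = (\<integral>z. log (exp 1) (h (\<phi> z)) \<partial>P)"
    unfolding P_density using h\<phi>_meas by (subst integral_real_density) (simp_all add: less_imp_le h_pos)
  also have "\<dots> = expectation (\<lambda>\<omega>. log (exp 1) (h (\<lambda>j\<in>{1..}. ZP j \<omega>)))"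
    unfolding P_def using h\<phi>_meas' by (subst integral_distr[OF pair_meas(1)]) (simp_all add: \<phi>_P del: One_nat_def)
  also have "\<dots> = expectation (\<lambda>\<omega>. \<Sum>k. l (Suc k) (ZP (Suc k) \<omega>))"
    by (simp add: h_def log_def)
  also have "\<dots> = (\<Sum>k. expectation (\<lambda>\<omega>. l (Suc k) (ZP (Suc k) \<omega>)))"
  proof (rule integral_suminf)
    show int: "integrable M (\<lambda>\<omega>. l (Suc k) (ZP (Suc k) \<omega>))" for k
      using moments(2)[of "Suc k"] by (simp add: integrable_distr_eq ZP_rv)
    have *: "summable (\<lambda>k. expectation (\<lambda>\<omega>. \<bar>l (Suc k) (ZP (Suc k) \<omega>)\<bar>))"
      using sums(2) by (simp add: integral_distr ZP_rv)
    then show "summable (\<lambda>k. expectation (\<lambda>\<omega>. norm (l (Suc k) (ZP (Suc k) \<omega>))))"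
      by simp
    show "AE \<omega> in M. summable (\<lambda>k. norm (l (Suc k) (ZP (Suc k) \<omega>)))"
      using AE_summable_if_summable_integral[OF int *] by simp
  qed
  also have "\<dots> = (\<Sum>k. ln (1 + n * a (Suc k)) / 2)"
  proof (rule suminf_cong)
    fix k
    show "expectation (\<lambda>\<omega>. l (Suc k) (ZP (Suc k) \<omega>)) = ln (1 + n * a (Suc k)) / 2"
      using gaussian_channel.expectation_log_density_observation[OF channel[of "Suc k"]]
      by (simp add: l_def ZP_def Y_eq g2(1))
  qed
  also have "2 * \<dots> = (\<Sum>k. ln (1 + n * a (Suc k)))"
  proof -
    have "summable (\<lambda>k. ln (1 + n * a (Suc k)))"
    proof (rule summable_comparison_test')
      show "summable (\<lambda>k. n * a (Suc k))" using sum1 by (rule summable_mult)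
      show "norm (ln (1 + n * a (Suc k))) \<le> n * a (Suc k)" for k
        using n by (simp add: a ln_add_one_self_le_self)
    qed
    then show ?thesis by (simp add: suminf_divide)
  qed
  finally show ?thesis .
qed

end

section \<open>Asymptotics of the information series\<close>

text \<open>The intervals (k, k + 1] tile the positive half-line and the ceiling equals k + 1 on
  each, so every term from index 1 on is met with weight 1 and \<open>h 0\<close> never.\<close>

lemma nn_integral_ceiling:
  fixes h :: "nat \<Rightarrow> ennreal"
  shows "(\<integral>\<^sup>+x. h (nat \<lceil>x::real\<rceil>) * indicator {0<..} x \<partial>lborel) = (\<Sum>k. h (Suc k))"
proof -
  have "(\<integral>\<^sup>+x. h (nat \<lceil>x::real\<rceil>) * indicator {0<..} x \<partial>lborel) =
      (\<integral>\<^sup>+x. (\<Sum>k. h (Suc k) * indicator {real k<..real (Suc k)} x) \<partial>lborel)"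
  proof (rule nn_integral_cong)
    fix x :: real
    show "h (nat \<lceil>x\<rceil>) * indicator {0<..} x = (\<Sum>k. h (Suc k) * indicator {real k<..real (Suc k)} x)"
    proof (cases "x > 0")
      case True
      then obtain m where m: "nat \<lceil>x\<rceil> = Suc m"
        by (metis not0_implies_Suc nat_0_iff ceiling_le_zero not_less)
      have "x \<in> {real k<..real (Suc k)} \<longleftrightarrow> k = m" for k
        using m True by (auto simp: greaterThanAtMost_iff) linarith+
      then have "h (Suc k) * indicator {real k<..real (Suc k)} x = (if k = m then h (Suc m) else 0)" for k
        by (auto simp: indicator_def)
      moreover have "(\<Sum>k. if k = m then h (Suc m) else 0) = h (Suc m)"
        using sums_single[of m "\<lambda>_. h (Suc m)"] by (simp add: sums_iff)
      ultimately show ?thesis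
        using True m by simp
    next
      case False
      then have "x \<notin> {real k<..real (Suc k)}" for k
        by auto
      then show ?thesis
        using False by simp
    qed
  qed
  also have "\<dots> = (\<Sum>k. \<integral>\<^sup>+x. h (Suc k) * indicator {real k<..real (Suc k)} x \<partial>lborel)"
    by (rule nn_integral_suminf) measurable
  also have "\<dots> = (\<Sum>k. h (Suc k))"
    by (simp add: nn_integral_cmult_indicator)
  finally show ?thesis .
qed

lemma integral_ceiling:
  fixes h :: "nat \<Rightarrow> real"
  assumes "\<And>k. h k \<ge> 0" "summable (\<lambda>k. h (Suc k))"
  shows "(\<integral>x. h (nat \<lceil>x::real\<rceil>) * indicator {0<..} x \<partial>lborel) = (\<Sum>k. h (Suc k))"
proof -
  have "(\<integral>\<^sup>+x. ennreal (h (nat \<lceil>x::real\<rceil>) * indicator {0<..} x) \<partial>lborel) =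
      (\<integral>\<^sup>+x. ennreal (h (nat \<lceil>x::real\<rceil>)) * indicator {0<..} x \<partial>lborel)"
    by (intro nn_integral_cong) (auto split: split_indicator)
  also have "\<dots> = (\<Sum>k. ennreal (h (Suc k)))"
    by (rule nn_integral_ceiling)
  also have "\<dots> = ennreal (\<Sum>k. h (Suc k))"
    using assms by (intro suminf_ennreal2) auto
  finally show ?thesis
    using assms by (intro integral_eq_nn_integral[THEN trans]) (auto simp: suminf_nonneg)
qed

lemma integrable_exp_neg_powr:
  fixes k \<beta> :: real
  assumes "k > 0" "\<beta> > 0"
  shows "integrable lborel (\<lambda>x. exp (- k * x powr \<beta>) * indicator {0<..} x)"
proof -
  have "((\<lambda>x. exp (- k * x powr \<beta>) * (1 + x\<^sup>2)) \<longlongrightarrow> 0) at_top"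
    using assms by real_asymp
  then have "eventually (\<lambda>x. exp (- k * x powr \<beta>) * (1 + x\<^sup>2) < 1) at_top"
    by (rule order_tendstoD) simp
  then obtain X where X: "\<And>x. x \<ge> X \<Longrightarrow> exp (- k * x powr \<beta>) * (1 + x\<^sup>2) < 1"
    by (auto simp: eventually_at_top_linorder)
  have "integrable lborel (\<lambda>x::real. inverse (1 + x\<^sup>2))"
    using integrable_inverse_1_plus_square by (simp add: set_integrable_def)
  \<comment> \<open>The factor 1 + X^2 serves both ranges: it is at least 1 for x \<ge> X, and it
    bounds 1 + x^2 for 0 < x < X, where the exponential is at most 1.\<close>
  then have "integrable lborel (\<lambda>x. (1 + X\<^sup>2) * inverse (1 + x\<^sup>2))"
    by simp
  then show ?thesis
  proof (rule Bochner_Integration.integrable_bound)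
    show "AE x in lborel. norm (exp (- k * x powr \<beta>) * indicator {0<..} x)
      \<le> norm ((1 + X\<^sup>2) * inverse (1 + x\<^sup>2))"
    proof (intro AE_I2)
      fix x :: real
      have "exp (- k * x powr \<beta>) * (1 + x\<^sup>2) \<le> 1 + X\<^sup>2" if "x > 0"
      proof (cases "x \<ge> X")
        case True
        then show ?thesis using X[of x] by (smt (verit) zero_le_power2)
      next
        case False
        have "exp (- k * x powr \<beta>) * (1 + x\<^sup>2) \<le> 1 * (1 + X\<^sup>2)"
          using assms False that by (intro mult_mono add_mono power_mono) auto
        then show ?thesis by simp
      qed
      moreover have "1 + x\<^sup>2 > 0"
        by (simp add: add_pos_nonneg)
      ultimately show "norm (exp (- k * x powr \<beta>) * indicator {0<..} x)
          \<le> norm ((1 + X\<^sup>2) * inverse (1 + x\<^sup>2))"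
        by (auto simp: field_simps split: split_indicator)
    qed
  qed auto
qed

text \<open>On x > 0 the integrand is supported up to X with c X^\<beta> = 1, where the integral is
  X - X / (\<beta> + 1). Integrability links the gauge integral computed here to the Lebesgue
  integral.\<close>

lemma integral_pos_part_powr:
  fixes c \<beta> :: real
  assumes "c > 0" "\<beta> > 0"
    and int: "integrable lborel (\<lambda>x. max 0 (1 - c * x powr \<beta>) * indicator {0<..} x)"
  shows "(\<integral>x. max 0 (1 - c * x powr \<beta>) * indicator {0<..} x \<partial>lborel) = \<beta> / (\<beta> + 1) * c powr (- 1 / \<beta>)"
proof -
  define X where "X = c powr (- 1 / \<beta>)"
  have X: "X > 0" "c * X powr \<beta> = 1"
    using assms by (simp_all add: X_def powr_powr powr_neg_one)
  have "((\<lambda>_. 1::real) has_integral 1 * (X - 0)) {0..X}"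
    using has_integral_const_real[of "1::real" 0 X] X by simp
  then have "((\<lambda>x. 1 - c * x powr \<beta>) has_integral (1 * (X - 0) - c * (X powr (\<beta> + 1) / (\<beta> + 1)))) {0..X}"
    using X assms by (intro has_integral_diff has_integral_mult_right has_integral_powr_from_0) auto
  also have "1 * (X - 0) - c * (X powr (\<beta> + 1) / (\<beta> + 1)) = \<beta> / (\<beta> + 1) * X"
  proof -
    have "c * X powr (\<beta> + 1) = X"
      using X by (simp add: powr_add)
    then have "1 * (X - 0) - c * (X powr (\<beta> + 1) / (\<beta> + 1)) = X - X / (\<beta> + 1)"
      by simp
    then show ?thesis using assms by (simp add: field_simps)
  qed
  finally have has: "((\<lambda>x. if x \<in> {0..X} then 1 - c * x powr \<beta> else 0) has_integral \<beta> / (\<beta> + 1) * X) UNIV"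
    by (simp only: has_integral_restrict_UNIV)
  \<comment> \<open>At x = 0 the left side is 0 and the right side 1; a single point is
    negligible.\<close>
  have eq: "max 0 (1 - c * x powr \<beta>) * indicator {0<..} x = (if x \<in> {0..X} then 1 - c * x powr \<beta> else 0)"
    if "x \<in> UNIV - {0}" for x
  proof -
    have "c * x powr \<beta> \<le> 1 \<longleftrightarrow> x \<le> X" if "x > 0"
    proof -
      have "x powr \<beta> \<le> X powr \<beta> \<longleftrightarrow> x \<le> X"
        using assms X that powr_mono2[of \<beta> x X] powr_less_mono2[of \<beta> X x] by linarith
      moreover have "c * x powr \<beta> \<le> c * X powr \<beta> \<longleftrightarrow> x powr \<beta> \<le> X powr \<beta>"
        using assms by (intro mult_le_cancel_left_pos)
      ultimately show ?thesis using X by simp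
    qed
    then show ?thesis
      using that by (auto split: split_indicator)
  qed
  have "((\<lambda>x. max 0 (1 - c * x powr \<beta>) * indicator {0<..} x) has_integral \<beta> / (\<beta> + 1) * X) UNIV"
    by (rule has_integral_spike[OF negligible_sing eq has])
  then show ?thesis
    using has_integral_integral_lborel[OF int] unfolding X_def by (metis has_integral_unique)
qed

text \<open>Equivalence speaks only about large j. Halving c gives slack in the tail, and C absorbs
  the finitely many earlier indices, so that the bound holds for every j, as domination
  requires.\<close>

lemma asymp_equiv_powr_lower_bound:
  fixes q :: "nat \<Rightarrow> real"
  assumes q: "q \<sim>[at_top] (\<lambda>j. c * real j powr \<beta>)" and "c > 0"
  obtains C where "C \<ge> 0" "\<And>j. q j \<ge> c / 2 * real j powr \<beta> - C"
proof -
  have "eventually (\<lambda>j. c / 2 * real j powr \<beta> \<le> q j) at_top"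
  proof -
    have "((\<lambda>j. q j / (c * real j powr \<beta>)) \<longlongrightarrow> 1) at_top"
      using q by (rule asymp_equivD_strong)
        (use \<open>c > 0\<close> in \<open>auto intro!: eventually_mono[OF eventually_gt_at_top[of 0]]\<close>)
    then have "eventually (\<lambda>j. q j / (c * real j powr \<beta>) > 1 / 2) at_top"
      by (rule order_tendstoD) simp
    then show ?thesis
      using eventually_gt_at_top[of 0]
    proof eventually_elim
      case (elim j)
      then show ?case using \<open>c > 0\<close> by (simp add: field_simps)
    qed
  qed
  then obtain J where J: "\<And>j. j \<ge> J \<Longrightarrow> c / 2 * real j powr \<beta> \<le> q j"
    by (auto simp: eventually_at_top_linorder)
  define C where "C = (\<Sum>j<J. \<bar>c / 2 * real j powr \<beta> - q j\<bar>)"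
  have C: "C \<ge> 0" by (auto simp: C_def intro!: sum_nonneg)
  moreover have "q j \<ge> c / 2 * real j powr \<beta> - C" for j
  proof (cases "j < J")
    case True
    then have "\<bar>c / 2 * real j powr \<beta> - q j\<bar> \<le> C"
      unfolding C_def by (intro member_le_sum) auto
    then show ?thesis by linarith
  next
    case False
    then show ?thesis using J[of j] C by simp
  qed
  ultimately show ?thesis using that by blast
qed

text \<open>With q_j = - ln a_j the terms are a_j^r. The exponents r = 1 and r = 1/2 serve the two
  summability conditions of the information formula.\<close>

lemma summable_exp_neg_asymp_powr:
  fixes q :: "nat \<Rightarrow> real"
  assumes q: "q \<sim>[at_top] (\<lambda>j. c * real j powr \<beta>)" and "c > 0" "\<beta> > 0" "r > 0"
  shows "summable (\<lambda>j. exp (- r * q j))"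
proof -
  obtain C where C: "\<And>j. q j \<ge> c / 2 * real j powr \<beta> - C"
    using asymp_equiv_powr_lower_bound[OF q \<open>c > 0\<close>] by metis
  have "(\<lambda>j. exp (- (r * c / 2) * real j powr \<beta>)) \<in> O(\<lambda>j. 1 / real j ^ 2)"
    using assms by real_asymp
  moreover have "summable (\<lambda>j. 1 / real j ^ 2)"
    using inverse_power_summable[of 2] by (simp add: inverse_eq_divide)
  ultimately have "summable (\<lambda>j. exp (- (r * c / 2) * real j powr \<beta>))"
    using summable_comparison_test_bigo[of "\<lambda>j. 1 / real j ^ 2"] by simp
  then have "summable (\<lambda>j. exp (r * C) * exp (- (r * c / 2) * real j powr \<beta>))"
    by (rule summable_mult)
  then show ?thesis
  proof (rule summable_comparison_test')
    fix j
    have "r * (c / 2 * real j powr \<beta> - C) \<le> r * q j"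
      using C[of j] \<open>r > 0\<close> by (intro mult_left_mono) auto
    then show "norm (exp (- r * q j)) \<le> exp (r * C) * exp (- (r * c / 2) * real j powr \<beta>)"
      by (simp add: algebra_simps flip: exp_add)
  qed
qed

text \<open>The function stays within ln 2 of the positive part, an error that vanishes after
  division by T; the last bound serves the tail, where x is very negative.\<close>

lemma ln_one_plus_exp_bounds:
  fixes x :: real
  shows "max 0 x \<le> ln (1 + exp x)" "ln (1 + exp x) \<le> ln 2 + max 0 x" "ln (1 + exp x) \<le> exp x"
proof -
  have "ln (exp x) \<le> ln (1 + exp x)"
    by (subst ln_le_cancel_iff) (auto simp: add_pos_pos)
  then show "max 0 x \<le> ln (1 + exp x)"
    by auto
  have "ln (1 + exp x) \<le> ln (2 * exp (max 0 x))"
    by (subst ln_le_cancel_iff) (auto simp: add_pos_pos max_def)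
  also have "\<dots> = ln 2 + max 0 x"
    by (simp add: ln_mult)
  finally show "ln (1 + exp x) \<le> ln 2 + max 0 x" .
  show "ln (1 + exp x) \<le> exp x"
    by (rule ln_add_one_self_le_self) simp
qed

text \<open>
  After the substitution \<open>j = \<lceil>T\<^bsup>1/\<beta>\<^esup> x\<rceil>\<close> the series becomes an integral over \<open>x > 0\<close>
  whose integrand, divided by \<open>T\<close>, tends to the positive part of \<open>1 - c x\<^sup>\<beta>\<close>.
\<close>

lemma suminf_ln_one_plus_exp_tendsto:
  fixes q :: "nat \<Rightarrow> real"
  assumes q: "q \<sim>[at_top] (\<lambda>j. c * real j powr \<beta>)" and c: "c > 0" and \<beta>: "\<beta> > 0"
  shows "((\<lambda>T. (\<Sum>k. ln (1 + exp (T - q (Suc k)))) / T powr (1 + 1 / \<beta>)) \<longlongrightarrow>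
           \<beta> / (\<beta> + 1) * c powr (- 1 / \<beta>)) at_top"
proof -
  obtain C where C: "C \<ge> 0" "\<And>j. q j \<ge> c / 2 * real j powr \<beta> - C"
    using asymp_equiv_powr_lower_bound[OF q c] by metis
  \<comment> \<open>Only one factor T is divided out here; the Jacobian of the rescaling accounts
    for the remaining T^(1/\<beta>).\<close>
  define w where "w = (\<lambda>T x. ln (1 + exp (T - q (nat \<lceil>T powr (1/\<beta>) * x\<rceil>))) / T * indicator {0<..} x)"
  define p where "p = (\<lambda>x::real. max 0 (1 - c * x powr \<beta>) * indicator {0<..} x)"
  \<comment> \<open>The sum \<open>C + 2 + exp C\<close> collects the constants of the two cases
    below, and the exponentials combine to exp (1 - v / 2) with v = (c / 2) x^\<beta>.\<close>
  define D where "D = (\<lambda>x. (C + 2 + exp C) * exp 1 * (exp (- (c / 4) * x powr \<beta>) * indicator {0<..} x))"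
  have w_meas[measurable]: "w T \<in> borel_measurable lborel" for T
    unfolding w_def by measurable
  have p_meas[measurable]: "p \<in> borel_measurable lborel"
    unfolding p_def by measurable
  have D_int: "integrable lborel D"
    unfolding D_def using c \<beta> by (intro integrable_mult_right integrable_exp_neg_powr) auto
  have bound: "norm (w T x) \<le> D x" if T: "T \<ge> 1" for T x
  proof (cases "x > 0")
    case False
    then show ?thesis by (simp add: w_def D_def)
  next
    case True
    define j where "j = nat \<lceil>T powr (1/\<beta>) * x\<rceil>"
    define v where "v = c / 2 * x powr \<beta>"
    have "real j \<ge> T powr (1/\<beta>) * x"
      unfolding j_def by linarith
    then have "real j powr \<beta> \<ge> (T powr (1/\<beta>) * x) powr \<beta>"
      using \<beta> True by (intro powr_mono2) auto
    also have "(T powr (1/\<beta>) * x) powr \<beta> = T * x powr \<beta>"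
      using T True \<beta> by (simp add: powr_mult powr_powr)
    finally have "c / 2 * (T * x powr \<beta>) \<le> c / 2 * real j powr \<beta>"
      using c by (intro mult_left_mono) auto
    then have u: "T - q j \<le> C + T * (1 - v)"
      using C(2)[of j] by (simp add: v_def algebra_simps)
    have v: "v \<ge> 0" using c by (simp add: v_def)
    \<comment> \<open>For v \<le> 2 the exponential is at least 1, so a constant bound suffices. For
      v > 2 the factor 1 - v is negative and T \<ge> 1 gives T (1 - v) \<le> 1 - v.\<close>
    have "ln (1 + exp (T - q j)) / T \<le> (C + 2 + exp C) * exp (1 - v / 2)"
    proof (cases "v \<le> 2")
      case True
      have "ln (1 + exp (T - q j)) \<le> ln 2 + max 0 (T - q j)"
        by (rule ln_one_plus_exp_bounds)
      also have "\<dots> \<le> 1 + (C + T)"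
      proof -
        have "T * (1 - v) \<le> T * 1" using v T by (intro mult_left_mono) auto
        then have "T - q j \<le> C + T" using u by linarith
        then have "max 0 (T - q j) \<le> C + T" using C T by simp
        then show ?thesis using ln_2_less_1 by linarith
      qed
      also have "\<dots> \<le> T * (C + 2)"
      proof -
        have "1 * C \<le> T * C" using T C by (intro mult_right_mono) auto
        then show ?thesis using T by (simp add: algebra_simps)
      qed
      finally have "ln (1 + exp (T - q j)) / T \<le> (C + 2) * 1"
        using T by (simp add: field_simps)
      also have "\<dots> \<le> (C + 2 + exp C) * exp (1 - v / 2)"
        using True C by (intro mult_mono) auto
      finally show ?thesis .
    next
      case False
      have "ln (1 + exp (T - q j)) / T \<le> ln (1 + exp (T - q j)) / 1"
        using T by (intro divide_left_mono) auto
      also have "\<dots> \<le> exp (T - q j)"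
        using ln_one_plus_exp_bounds by simp
      also have "\<dots> \<le> exp (C + (1 - v / 2))"
      proof -
        have "T * (1 - v) \<le> 1 * (1 - v)"
          using T False by (intro mult_right_mono_neg) auto
        also have "\<dots> \<le> 1 - v / 2"
          using False by simp
        finally show ?thesis using u by simp
      qed
      also have "\<dots> \<le> (C + 2 + exp C) * exp (1 - v / 2)"
        using C by (simp only: exp_add) (intro mult_right_mono, auto)
      finally show ?thesis .
    qed
    also have "\<dots> = (C + 2 + exp C) * exp 1 * exp (- (c / 4) * x powr \<beta>)"
      by (simp add: v_def flip: exp_add)
    finally show ?thesis
      using True T by (simp add: w_def D_def j_def)
  qed
  have lim: "((\<lambda>T. w T x) \<longlongrightarrow> p x) at_top" for x
  proof (cases "x > 0")
    case False
    then show ?thesis by (simp add: w_def p_def)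
  next
    case True
    define j where "j = (\<lambda>T. nat \<lceil>T powr (1/\<beta>) * x\<rceil>)"
    have "filterlim (\<lambda>T. T powr (1/\<beta>) * x) at_top at_top"
      using True \<beta> by real_asymp
    then have "filterlim (\<lambda>T. real (j T)) at_top at_top"
      by (rule filterlim_at_top_mono) (auto simp: j_def intro!: always_eventually real_nat_ceiling_ge)
    then have j_top: "filterlim j at_top at_top"
      by (simp add: filterlim_sequentially_iff_filterlim_real)
    have "((\<lambda>T. real_of_int \<lceil>T powr (1/\<beta>) * x\<rceil> / T powr (1/\<beta>)) \<longlongrightarrow> x) at_top"
      using True \<beta> by real_asymp
    moreover have "eventually (\<lambda>T. real_of_int \<lceil>T powr (1/\<beta>) * x\<rceil> / T powr (1/\<beta>) = real (j T) / T powr (1/\<beta>)) at_top"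
      using eventually_gt_at_top[of 0]
    proof eventually_elim
      case (elim T)
      have "\<lceil>T powr (1/\<beta>) * x\<rceil> \<ge> 0"
        using True by (simp add: ceiling_le_iff le_ceiling_iff mult_pos_pos less_le_trans[of "-1" 0])
      then show ?case by (simp add: j_def)
    qed
    ultimately have jx: "((\<lambda>T. real (j T) / T powr (1/\<beta>)) \<longlongrightarrow> x) at_top"
      by (rule Lim_transform_eventually)
    have "((\<lambda>j. q j / (c * real j powr \<beta>)) \<longlongrightarrow> 1) at_top"
      using q by (rule asymp_equivD_strong) (use c in \<open>auto intro!: eventually_mono[OF eventually_gt_at_top[of 0]]\<close>)
    then have "((\<lambda>T. q (j T) / (c * real (j T) powr \<beta>)) \<longlongrightarrow> 1) at_top"
      using j_top by (rule filterlim_compose)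
    \<comment> \<open>The quotient q_j / T is split into q_j / (c j^\<beta>), which tends to 1, and
      c (j / T^(1/\<beta>))^\<beta>, which tends to c x^\<beta>.\<close>
    then have "((\<lambda>T. q (j T) / (c * real (j T) powr \<beta>) * (c * (real (j T) / T powr (1/\<beta>)) powr \<beta>)) \<longlongrightarrow> 1 * (c * x powr \<beta>)) at_top"
      using jx True \<beta> by (intro tendsto_mult tendsto_const tendsto_powr) auto
    moreover have "eventually (\<lambda>T. q (j T) / (c * real (j T) powr \<beta>) * (c * (real (j T) / T powr (1/\<beta>)) powr \<beta>) = q (j T) / T) at_top"
      using eventually_gt_at_top[of 0] eventually_compose_filterlim[OF eventually_gt_at_top[of 0] j_top]
    proof eventually_elim
      case (elim T)
      then have "(real (j T) / T powr (1/\<beta>)) powr \<beta> = real (j T) powr \<beta> / T"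
        using \<beta> by (simp add: powr_divide powr_powr)
      then show ?case using elim c by (simp add: field_simps)
    qed
    ultimately have qT: "((\<lambda>T. q (j T) / T) \<longlongrightarrow> 1 * (c * x powr \<beta>)) at_top"
      by (rule Lim_transform_eventually)
    have lo: "((\<lambda>T. max 0 (1 - q (j T) / T)) \<longlongrightarrow> max 0 (1 - 1 * (c * x powr \<beta>))) at_top"
      using qT by (intro tendsto_max tendsto_const tendsto_diff)
    have "((\<lambda>T::real. ln 2 / T) \<longlongrightarrow> 0) at_top"
      by real_asymp
    then have hi: "((\<lambda>T. ln 2 / T + max 0 (1 - q (j T) / T)) \<longlongrightarrow> 0 + max 0 (1 - 1 * (c * x powr \<beta>))) at_top"
      using lo by (rule tendsto_add)
    have max_eq: "max 0 (T - q (j T)) / T = max 0 (1 - q (j T) / T)" if "T > 0" for T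
      using that by (auto simp: max_def field_simps)
    have "((\<lambda>T. ln (1 + exp (T - q (j T))) / T) \<longlongrightarrow> max 0 (1 - 1 * (c * x powr \<beta>))) at_top"
    proof (rule tendsto_sandwich[OF _ _ lo])
      show "eventually (\<lambda>T. max 0 (1 - q (j T) / T) \<le> ln (1 + exp (T - q (j T))) / T) at_top"
        using eventually_gt_at_top[of 0]
      proof eventually_elim
        case (elim T)
        then show ?case
          using divide_right_mono[OF ln_one_plus_exp_bounds(1)[of "T - q (j T)"], of T] max_eq by simp
      qed
      show "eventually (\<lambda>T. ln (1 + exp (T - q (j T))) / T \<le> ln 2 / T + max 0 (1 - q (j T) / T)) at_top"
        using eventually_gt_at_top[of 0]
      proof eventually_elim
        case (elim T)
        then show ?case
          using divide_right_mono[OF ln_one_plus_exp_bounds(2)[of "T - q (j T)"], of T] max_eq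
          by (simp add: add_divide_distrib)
      qed
      show "((\<lambda>T. ln 2 / T + max 0 (1 - q (j T) / T)) \<longlongrightarrow> max 0 (1 - 1 * (c * x powr \<beta>))) at_top"
        using hi by simp
    qed
    then show ?thesis
      using True by (simp add: w_def p_def j_def)
  qed
  have ev_bound: "eventually (\<lambda>T. AE x in lborel. norm (w T x) \<le> D x) at_top"
    using eventually_ge_at_top[of 1] by eventually_elim (intro AE_I2 bound)
  note dom = p_meas w_meas D_int AE_I2[OF lim] ev_bound
  have "((\<lambda>T. \<integral>x. w T x \<partial>lborel) \<longlongrightarrow> (\<integral>x. p x \<partial>lborel)) at_top"
    by (rule integral_dominated_convergence_at_top[OF dom])
  also have "(\<integral>x. p x \<partial>lborel) = \<beta> / (\<beta> + 1) * c powr (- 1 / \<beta>)"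
    using integrable_dominated_convergence_at_top[OF dom] c \<beta> unfolding p_def
    by (intro integral_pos_part_powr) auto
  finally show ?thesis
  proof (rule Lim_transform_eventually)
    show "eventually (\<lambda>T. (\<integral>x. w T x \<partial>lborel) = (\<Sum>k. ln (1 + exp (T - q (Suc k)))) / T powr (1 + 1 / \<beta>)) at_top"
      using eventually_gt_at_top[of 0]
    proof eventually_elim
      case (elim T)
      define s where "s = T powr (1/\<beta>)"
      have s: "s > 0" using elim by (simp add: s_def)
      let ?h = "\<lambda>j. ln (1 + exp (T - q j))"
      have "summable (\<lambda>j. exp T * exp (- 1 * q j))"
        by (intro summable_mult summable_exp_neg_asymp_powr[OF q c \<beta>]) simp
      then have "summable ?h"
      proof (rule summable_comparison_test')
        show "norm (?h j) \<le> exp T * exp (- 1 * q j)" for j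
          using ln_one_plus_exp_bounds[of "T - q j"] by (simp add: exp_diff exp_minus field_simps)
      qed
      then have sum: "summable (\<lambda>k. ?h (Suc k))"
        by (subst summable_Suc_iff)
      have h_nonneg: "?h k \<ge> 0" for k
        by simp
      have "(\<Sum>k. ?h (Suc k)) = (\<integral>x. ?h (nat \<lceil>x::real\<rceil>) * indicator {0<..} x \<partial>lborel)"
        by (rule integral_ceiling[OF h_nonneg sum, symmetric])
      \<comment> \<open>The Jacobian s = T^(1/\<beta>) and the factor T in front of \<open>w\<close>
        together make up the normalisation T^(1 + 1/\<beta>).\<close>
      also have "\<dots> = \<bar>s\<bar> *\<^sub>R (\<integral>x. ?h (nat \<lceil>0 + s * x\<rceil>) * indicator {0<..} (0 + s * x) \<partial>lborel)"
        using s by (intro lborel_integral_real_affine) auto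
      also have "(\<lambda>x. ?h (nat \<lceil>0 + s * x\<rceil>) * indicator {0<..} (0 + s * x)) = (\<lambda>x. T * w T x)"
        using s elim by (auto simp: fun_eq_iff w_def s_def zero_less_mult_iff split: split_indicator)
      finally show ?case
        using s elim by (simp add: s_def powr_add field_simps)
    qed
  qed
qed

section \<open>From the series to the two equivalences\<close>

theorem theorem2:
  fixes M :: "'a measure"
    and \<theta> \<epsilon> :: "nat \<Rightarrow> 'a \<Rightarrow> real"
    and \<kappa> \<tau> a :: "nat \<Rightarrow> real"
    and \<sigma> c \<beta> :: real
  assumes "gaussian_sequence_experiment M \<theta> \<epsilon> \<kappa> \<tau> \<sigma>"
    and "\<And>j. j \<ge> 1 \<Longrightarrow> a j = (\<kappa> j)\<^sup>2 * (\<tau> j)\<^sup>2 / \<sigma>\<^sup>2"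
    and "c > 0" and "\<beta> > 0"
    and "(\<lambda>j. - ln (a j)) \<sim>[at_top] (\<lambda>j. c * real j powr \<beta>)"
  shows "(\<lambda>n. 2 * mutual_info M \<theta> \<epsilon> \<kappa> n)
           \<sim>[at_top] (\<lambda>n. \<beta> / (\<beta> + 1) * c powr (- 1 / \<beta>) * ln n powr (1 + 1 / \<beta>))
       \<and> (\<lambda>n. effective_dim M \<theta> \<epsilon> \<kappa> n)
           \<sim>[at_top] (\<lambda>n. \<beta> / (\<beta> + 1) * c powr (- 1 / \<beta>) * ln n powr (1 / \<beta>))"
proof
  interpret gaussian_sequence_experiment M \<theta> \<epsilon> \<kappa> \<tau> \<sigma> by fact
  define K where "K = \<beta> / (\<beta> + 1) * c powr (- 1 / \<beta>)"
  define I where "I = (\<lambda>n. 2 * mutual_info M \<theta> \<epsilon> \<kappa> n)"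
  have K: "K \<noteq> 0"
    using assms(3,4) by (simp add: K_def)
  \<comment> \<open>The shift to \<open>Suc k\<close> matters: \<open>a 0\<close> is unconstrained,
    and positivity is what makes exp (ln a_j) = a_j.\<close>
  have a_pos: "a (Suc k) > 0" for k
    using assms(2)[of "Suc k"] \<kappa>_pos[of "Suc k"] \<tau>_pos[of "Suc k"] \<sigma>_pos by simp
  have sum: "summable (\<lambda>k. exp (r * ln (a (Suc k))))" if "r > 0" for r
    using summable_exp_neg_asymp_powr[OF assms(5,3,4) that]
    by (subst summable_Suc_iff) simp
  have sum1: "summable (\<lambda>k. a (Suc k))"
    using sum[of 1] a_pos by simp
  have sum2: "summable (\<lambda>k. sqrt (a (Suc k)))"
  proof -
    have "sqrt (a (Suc k)) = exp (1 / 2 * ln (a (Suc k)))" for k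
      using a_pos[of k] powr_half_sqrt[of "a (Suc k)"] by (simp add: powr_def)
    then show ?thesis using sum[of "1 / 2"] by simp
  qed
  have "((\<lambda>T. (\<Sum>k. ln (1 + exp (T - - ln (a (Suc k))))) / T powr (1 + 1 / \<beta>)) \<longlongrightarrow> K) at_top"
    unfolding K_def by (rule suminf_ln_one_plus_exp_tendsto[OF assms(5,3,4)])
  \<comment> \<open>With T = ln n, exp (T + ln a_j) is n a_j, so the series is the one in the
    information formula.\<close>
  then have "((\<lambda>n. (\<Sum>k. ln (1 + exp (ln n - - ln (a (Suc k))))) / ln n powr (1 + 1 / \<beta>)) \<longlongrightarrow> K) at_top"
    by (rule filterlim_compose[OF _ ln_at_top])
  then have "((\<lambda>n. I n / ln n powr (1 + 1 / \<beta>)) \<longlongrightarrow> K) at_top"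
  proof (rule Lim_transform_eventually)
    show "eventually (\<lambda>n. (\<Sum>k. ln (1 + exp (ln n - - ln (a (Suc k))))) / ln n powr (1 + 1 / \<beta>) =
        I n / ln n powr (1 + 1 / \<beta>)) at_top"
      using eventually_gt_at_top[of 0]
    proof eventually_elim
      case (elim n)
      then show ?case
        using two_mutual_info[OF elim assms(2) sum1 sum2] a_pos by (simp add: I_def exp_add)
    qed
  qed
  then have *: "I \<sim>[at_top] (\<lambda>n. K * ln n powr (1 + 1 / \<beta>))"
    using K by (rule asymp_equivI'_const)
  then show "(\<lambda>n. 2 * mutual_info M \<theta> \<epsilon> \<kappa> n)
      \<sim>[at_top] (\<lambda>n. \<beta> / (\<beta> + 1) * c powr (- 1 / \<beta>) * ln n powr (1 + 1 / \<beta>))"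
    by (simp add: I_def K_def)
  have "(\<lambda>n. I n / ln n) \<sim>[at_top] (\<lambda>n. K * ln n powr (1 + 1 / \<beta>) / ln n)"
    using * by (rule asymp_equiv_divide) simp
  also have "eventually (\<lambda>n. K * ln n powr (1 + 1 / \<beta>) / ln n = K * ln n powr (1 / \<beta>)) at_top"
    using eventually_gt_at_top[of 1] by eventually_elim (simp add: powr_add)
  finally show "(\<lambda>n. effective_dim M \<theta> \<epsilon> \<kappa> n)
      \<sim>[at_top] (\<lambda>n. \<beta> / (\<beta> + 1) * c powr (- 1 / \<beta>) * ln n powr (1 / \<beta>))"
    by (simp add: I_def K_def effective_dim_def[abs_def])
qed

end
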